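(* Let $n\ge 2$. There exist constants $c,c_0>0$, independent of $\kappa$, $t$ and $\omega$, such that the following holds for every $\kappa\ge1$. If $\omega:\mathbb{R}_+\to\mathbb{R}_+$ is a non-decreasing function such that $$\|h\|_{L^2(\mathbb{R}^n)}\le\omega\left(\|F_\kappa(h)\|_{\mathrm{HS}}\right)\quad\text{for all } h\in H^1_{\overline{B}_1}\text{ with }\|h\|_{H^1(\mathbb{R}^n)}\le1,$$ then $$\omega(t)\ge c\,\max\left\{t,\ \kappa^{-1}\left(\log\kappa+\log(1/t)\right)^{-2}\right\}\quad\text{for all } 0<t\le c_0.$$
   Context: $\mathbb{R}_+=[0,\infty)$; $B_1$ is the open unit ball in $\mathbb{R}^n$; $H^1_{\overline{B}_1}=\{f\in H^1(\mathbb{R}^n):\operatorname{supp}(f)\subset\overline{B}_1\}$ with the norm of $H^1(\mathbb{R}^n)$. $\|\cdot\|_{\mathrm{HS}}$ is the Hilbert-Schmidt norm of operators on $L^2(\mathbb{S}^{n-1})$. For $f\in L^2(\mathbb{S}^{n-1})$ and $\kappa>0$, $(P_\kappa f)(x)=\int_{\mathbb{S}^{n-1}}e^{\mathbf{i}\kappa\omega\cdot x}f(\omega)\,\mathrm{d}S(\omega)$ for $x\in\mathbb{R}^n$. For $h\in L^2(\mathbb{R}^n)$ supported in $\overline{B}_1$, $F_\kappa(h)$ is the (Hilbert-Schmidt) operator on $L^2(\mathbb{S}^{n-1})$ determined by $$(F_\kappa(h)f,g)_{L^2(\mathbb{S}^{n-1})}=\kappa^{\frac{n-1}{2}}\int_{B_1}h\,P_\kappa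 f\,\overline{P_\kappa g}\,\mathrm{d}x\quad\text{for } f,g\in L^2(\mathbb{S}^{n-1}).$$ *)

theory Defs
  imports "HOL-Analysis.Analysis"
begin

text \<open>
  Elements of an \<open>L\<^sup>2\<close> space are represented by square-integrable functions; equality in
  \<open>L\<^sup>2(M)\<close> is equality almost everywhere with respect to \<open>M\<close>.
\<close>

definition L2 :: "'a measure \<Rightarrow> ('a \<Rightarrow> complex) set" where
  "L2 M = {f \<in> borel_measurable M. integrable M (\<lambda>x. (cmod (f x))\<^sup>2)}"

definition L2_inner :: "'a measure \<Rightarrow> ('a \<Rightarrow> complex) \<Rightarrow> ('a \<Rightarrow> complex) \<Rightarrow> complex" where
  "L2_inner M f g = (LINT x|M. f x * cnj (g x))"

definition L2_norm :: "'a measure \<Rightarrow> ('a \<Rightarrow> complex) \<Rightarrow> real" where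
  "L2_norm M f = sqrt (LINT x|M. (cmod (f x))\<^sup>2)"

definition orthonormal_basis :: "'a measure \<Rightarrow> ('a \<Rightarrow> complex) set \<Rightarrow> bool" where
  "orthonormal_basis M E \<longleftrightarrow>
     E \<subseteq> L2 M \<and>
     (\<forall>e\<in>E. \<forall>e'\<in>E. L2_inner M e e' = (if e = e' then 1 else 0)) \<and>
     (\<forall>f\<in>L2 M. (\<forall>e\<in>E. L2_inner M f e = 0) \<longrightarrow> (AE x in M. f x = 0))"

text \<open>
  The sum does not depend on the orthonormal basis. It is meaningful for Hilbert--Schmidt
  operators only: for other operators the sum diverges and \<^const>\<open>infsum\<close> returns \<open>0\<close>.
\<close>

definition HS_norm :: "'a measure \<Rightarrow> (('a \<Rightarrow> complex) \<Rightarrow> ('a \<Rightarrow> complex)) \<Rightarrow> real" where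
  "HS_norm M T =
     (let E = (SOME E. orthonormal_basis M E) in sqrt (\<Sum>\<^sub>\<infinity>e\<in>E. (L2_norm M (T e))\<^sup>2))"

definition partial_deriv :: "'n::finite \<Rightarrow> (real^'n \<Rightarrow> complex) \<Rightarrow> real^'n \<Rightarrow> complex" where
  "partial_deriv i f x = frechet_derivative f (at x) (axis i 1)"

primrec C_k :: "nat \<Rightarrow> (real^'n::finite \<Rightarrow> complex) \<Rightarrow> bool" where
  "C_k 0 f \<longleftrightarrow> continuous_on UNIV f"
| "C_k (Suc k) f \<longleftrightarrow> f differentiable_on UNIV \<and> (\<forall>i. C_k k (partial_deriv i f))"

definition test_function :: "(real^'n::finite \<Rightarrow> complex) \<Rightarrow> bool" where
  "test_function \<phi> \<longleftrightarrow> (\<forall>k. C_k k \<phi>) \<and> compact (closure {x. \<phi> x \<noteq> 0})"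

definition is_weak_deriv ::
    "'n::finite \<Rightarrow> (real^'n \<Rightarrow> complex) \<Rightarrow> (real^'n \<Rightarrow> complex) \<Rightarrow> bool" where
  "is_weak_deriv i f g \<longleftrightarrow>
     (\<forall>\<phi>. test_function \<phi> \<longrightarrow>
        (LINT x|lborel. f x * partial_deriv i \<phi> x) = - (LINT x|lborel. g x * \<phi> x))"

definition H1 :: "(real^'n::finite \<Rightarrow> complex) set" where
  "H1 = {f \<in> L2 lborel. \<forall>i. \<exists>g\<in>L2 lborel. is_weak_deriv i f g}"

text \<open>The weak derivative is unique up to a null set.\<close>

definition weak_deriv :: "'n::finite \<Rightarrow> (real^'n \<Rightarrow> complex) \<Rightarrow> real^'n \<Rightarrow> complex" where
  "weak_deriv i f = (SOME g. g \<in> L2 lborel \<and> is_weak_deriv i f g)"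

definition H1_norm :: "(real^'n::finite \<Rightarrow> complex) \<Rightarrow> real" where
  "H1_norm f = sqrt ((L2_norm lborel f)\<^sup>2 + (\<Sum>i\<in>UNIV. (L2_norm lborel (weak_deriv i f))\<^sup>2))"

text \<open>
  The support of a function that is only defined almost everywhere: the complement of the
  largest open set on which it vanishes almost everywhere.
\<close>

definition ess_support :: "(real^'n::finite \<Rightarrow> complex) \<Rightarrow> (real^'n) set" where
  "ess_support f = - \<Union>{U. open U \<and> (AE x in lborel. x \<in> U \<longrightarrow> f x = 0)}"

definition H1_ball :: "(real^'n::finite \<Rightarrow> complex) set" where
  "H1_ball = {f \<in> H1. ess_support f \<subseteq> cball 0 1}"

text \<open>
  Surface measure of the unit sphere, normalised by integration in polar coordinates: the
  surface measure of \<open>A\<close> is \<open>n\<close> times the volume of the cone \<open>{r \<theta> | 0 < r < 1, \<theta> \<in> A}\<close>.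
\<close>

definition sphere_measure :: "(real^'n::finite) measure" where
  "sphere_measure =
     scale_measure (of_nat CARD('n))
       (distr (restrict_space lborel (ball 0 1 - {0})) (restrict_space borel (sphere 0 1))
          (\<lambda>x. x /\<^sub>R norm x))"

definition P_op :: "real \<Rightarrow> (real^'n::finite \<Rightarrow> complex) \<Rightarrow> real^'n \<Rightarrow> complex" where
  "P_op \<kappa> f x = (LINT \<theta>|sphere_measure. exp (\<i> * of_real (\<kappa> * (\<theta> \<bullet> x))) * f \<theta>)"

text \<open>The defining identity determines \<open>F_op \<kappa> h f\<close> up to a null set of the sphere.\<close>

definition F_op :: "real \<Rightarrow> (real^'n::finite \<Rightarrow> complex) \<Rightarrow>
    (real^'n \<Rightarrow> complex) \<Rightarrow> (real^'n \<Rightarrow> complex)" where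
  "F_op \<kappa> h f = (SOME u. u \<in> L2 sphere_measure \<and>
     (\<forall>g\<in>L2 sphere_measure. L2_inner sphere_measure u g =
        of_real (\<kappa> powr ((real CARD('n) - 1) / 2)) *
        (LINT x:ball 0 1|lborel. h x * P_op \<kappa> f x * cnj (P_op \<kappa> g x))))"

end

theory Submission
  imports Defs "HOL-Computational_Algebra.Polynomial" "HOL-Probability.Sinc_Integral"
begin

text \<open>
  The operator \<open>F\<^sub>\<kappa>(h)\<close> has the kernel \<open>\<kappa>\<^bsup>(n-1)/2\<^esup> \<integral> h(x) e\<^bsup>i\<kappa>(\<theta>-y)\<cdot>x\<^esup> dx\<close>, so its Hilbert--Schmidt
  norm only sees the Fourier transform of \<open>h\<close> on the ball of radius \<open>2\<kappa>\<close>. Both lower bounds come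
  from multiples of \<open>h(x) = \<Prod>\<^sub>i g(x\<^sub>i)\<close>, where \<open>g\<close> is the \<open>k\<close>-th finite difference, with step \<open>\<delta>\<close>,
  of one arch of a sine on \<open>(0, \<delta>)\<close>. The translates of the arch have disjoint supports, so that
  \<open>\<parallel>g'\<parallel> = (\<pi>/\<delta>) \<parallel>g\<parallel>\<close> in \<open>L\<^sup>2\<close>, while its Fourier transform is multiplied by \<open>(e\<^bsup>i\<delta>\<xi>\<^esup> - 1)\<^bsup>k\<^esup>\<close>.

  For the bound \<open>t\<close> take \<open>k = 0\<close> and \<open>\<delta>\<close> fixed. The square of the Fourier transform of \<open>h\<close> is then
  at most \<open>C \<Prod>\<^sub>i (1 + \<xi>\<^sub>i\<^sup>2)\<^bsup>-1\<^esup>\<close>, whose mean over a sphere of radius \<open>\<kappa>\<close> around any centre is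
  \<open>O(\<kappa>\<^bsup>-(n-1)\<^esup>)\<close>; hence \<open>F\<^sub>\<kappa>(h)\<close> is bounded uniformly in \<open>\<kappa>\<close>.

  For the logarithmic bound take \<open>\<delta>\<close> of size \<open>1/k\<close>, so that \<open>h\<close> stays supported in the ball. For
  \<open>k\<close> at least of size \<open>\<kappa>\<close> the factors \<open>\<bar>e\<^bsup>i\<delta>\<xi>\<^esup> - 1\<bar>\<^bsup>k\<^esup>\<close> are at most \<open>e\<^bsup>-k\<^esup>\<close>, while the \<open>H\<^sup>1\<close> norm of
  \<open>h\<close> exceeds its \<open>L\<^sup>2\<close> norm only by a factor \<open>O(k)\<close>. It remains to take \<open>k\<close> of size
  \<open>\<kappa> + log \<kappa> + log (1/t)\<close>.
\<close>

section \<open>Square-integrable functions\<close>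

lemma L2_measurable [measurable_dest]: "f \<in> L2 M \<Longrightarrow> f \<in> borel_measurable M"
  by (simp add: L2_def)

lemma borel_measurable_cnj [measurable]:
  assumes [measurable]: "f \<in> borel_measurable M"
  shows "(\<lambda>x. cnj (f x)) \<in> borel_measurable M"
  by (rule borel_measurable_continuous_on[OF continuous_on_cnj]) (auto intro: continuous_on_id)

lemma L2_finite_support:
  assumes [measurable]: "f \<in> borel_measurable M" "A \<in> sets M"
    and finite_measure_A: "emeasure M A < \<infinity>"
    and bounded: "\<And>x. cmod (f x) \<le> B" and support: "\<And>x. x \<in> space M \<Longrightarrow> x \<notin> A \<Longrightarrow> f x = 0"
  shows "f \<in> L2 M"
proof -
  have "norm ((cmod (f x))\<^sup>2) \<le> B\<^sup>2" for x
    using bounded[of x] by (simp add: power_mono)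
  then have "integrable M (\<lambda>x. (cmod (f x))\<^sup>2)"
    using finite_measure_A support
    by (intro integrableI_bounded_set[where A=A and B="B\<^sup>2"]) (auto intro!: AE_I2)
  then show ?thesis by (simp add: L2_def)
qed

lemma L2_integrable_mult_cnj:
  assumes "f \<in> L2 M" "g \<in> L2 M"
  shows "integrable M (\<lambda>x. f x * cnj (g x))"
proof (rule Bochner_Integration.integrable_bound)
  note [measurable] = assms[THEN L2_measurable]
  show "integrable M (\<lambda>x. (cmod (f x))\<^sup>2 + (cmod (g x))\<^sup>2)"
    using assms by (auto simp: L2_def)
  have "s * t \<le> s\<^sup>2 + t\<^sup>2" if "0 \<le> s" "0 \<le> t" for s t :: real
    using sum_squares_bound[of s t] mult_nonneg_nonneg[OF that] by linarith
  then show "AE x in M. norm (f x * cnj (g x)) \<le> norm ((cmod (f x))\<^sup>2 + (cmod (g x))\<^sup>2)"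
    by (simp add: norm_mult)
  show "(\<lambda>x. f x * cnj (g x)) \<in> borel_measurable M" by measurable
qed

lemma L2_cmult: "f \<in> L2 M \<Longrightarrow> (\<lambda>x. c * f x) \<in> L2 M"
  by (auto simp: L2_def norm_mult power_mult_distrib)

lemma L2_cnj: "f \<in> L2 M \<Longrightarrow> (\<lambda>x. cnj (f x)) \<in> L2 M"
  by (auto simp: L2_def)

lemma L2_add:
  assumes "f \<in> L2 M" "g \<in> L2 M"
  shows "(\<lambda>x. f x + g x) \<in> L2 M"
proof -
  note [measurable] = assms[THEN L2_measurable]
  have "integrable M (\<lambda>x. (cmod (f x + g x))\<^sup>2)"
  proof (rule Bochner_Integration.integrable_bound)
    show "integrable M (\<lambda>x. 2 * (cmod (f x))\<^sup>2 + 2 * (cmod (g x))\<^sup>2)"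
      using assms by (auto simp: L2_def)
    have "(cmod (a + b))\<^sup>2 \<le> 2 * (cmod a)\<^sup>2 + 2 * (cmod b)\<^sup>2" for a b
    proof -
      have "(cmod (a + b))\<^sup>2 \<le> (cmod a + cmod b)\<^sup>2"
        by (intro power_mono norm_triangle_ineq) auto
      then show ?thesis
        using sum_squares_bound[of "cmod a" "cmod b"] by (simp add: power2_sum)
    qed
    then show "AE x in M. norm ((cmod (f x + g x))\<^sup>2) \<le> norm (2 * (cmod (f x))\<^sup>2 + 2 * (cmod (g x))\<^sup>2)"
      by auto
  qed measurable
  then show ?thesis by (simp add: L2_def)
qed

lemma L2_diff: "f \<in> L2 M \<Longrightarrow> g \<in> L2 M \<Longrightarrow> (\<lambda>x. f x - g x) \<in> L2 M"
  using L2_add[of f M "\<lambda>x. - 1 * g x"] L2_cmult[of g M "-1"] by simp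

lemma L2_0: "(\<lambda>x. 0) \<in> L2 M"
  by (simp add: L2_def)

lemma L2_sum: "(\<And>e. e \<in> F \<Longrightarrow> f e \<in> L2 M) \<Longrightarrow> (\<lambda>x. \<Sum>e\<in>F. f e x) \<in> L2 M"
  by (induction F rule: infinite_finite_induct) (simp_all add: L2_0 L2_add)

lemma L2_norm_nonneg [simp]: "0 \<le> L2_norm M f"
  by (simp add: L2_norm_def)

lemma L2_norm_square: "(L2_norm M f)\<^sup>2 = (LINT x|M. (cmod (f x))\<^sup>2)"
  by (simp add: L2_norm_def)

lemma L2_norm_cmult: "L2_norm M (\<lambda>x. c * f x) = cmod c * L2_norm M f"
  by (simp add: L2_norm_def norm_mult power_mult_distrib real_sqrt_mult)

lemma L2_norm_cong_AE:
  assumes "f \<in> borel_measurable M" "g \<in> borel_measurable M" "AE x in M. f x = g x"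
  shows "L2_norm M f = L2_norm M g"
  unfolding L2_norm_def
  by (rule arg_cong[where f=sqrt], rule integral_cong_AE) (use assms in auto)

lemma L2_norm_eq_0_AE:
  assumes "f \<in> L2 M" "L2_norm M f = 0"
  shows "AE x in M. f x = 0"
proof -
  have "(LINT x|M. (cmod (f x))\<^sup>2) = 0"
    using assms(2) by (simp add: L2_norm_def)
  then have "AE x in M. (cmod (f x))\<^sup>2 = 0"
    using assms(1) by (subst (asm) integral_nonneg_eq_0_iff_AE) (auto simp: L2_def)
  then show ?thesis by auto
qed

lemma L2_inner_self: "L2_inner M f f = of_real ((L2_norm M f)\<^sup>2)"
  by (simp add: L2_inner_def L2_norm_square complex_norm_square[symmetric] del: of_real_power
      flip: of_real_power)

lemma L2_inner_cnj: "cnj (L2_inner M f g) = L2_inner M g f"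
proof -
  have "cnj (L2_inner M f g) = (LINT x|M. cnj (f x * cnj (g x)))"
    unfolding L2_inner_def by (rule Bochner_Integration.integral_cnj[symmetric])
  then show ?thesis by (simp add: L2_inner_def mult.commute)
qed

lemma L2_inner_diff_left:
  assumes "f \<in> L2 M" "g \<in> L2 M" "k \<in> L2 M"
  shows "L2_inner M (\<lambda>x. f x - g x) k = L2_inner M f k - L2_inner M g k"
  unfolding L2_inner_def left_diff_distrib
  by (intro Bochner_Integration.integral_diff L2_integrable_mult_cnj assms)

lemma L2_inner_diff_right:
  assumes "f \<in> L2 M" "g \<in> L2 M" "k \<in> L2 M"
  shows "L2_inner M k (\<lambda>x. f x - g x) = L2_inner M k f - L2_inner M k g"
  unfolding L2_inner_def complex_cnj_diff right_diff_distrib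
  by (intro Bochner_Integration.integral_diff L2_integrable_mult_cnj assms)

lemma L2_inner_cmult_left: "L2_inner M (\<lambda>x. c * f x) g = c * L2_inner M f g"
  by (simp add: L2_inner_def mult.assoc)

lemma L2_inner_cmult_right: "L2_inner M f (\<lambda>x. c * g x) = cnj c * L2_inner M f g"
  by (simp add: L2_inner_def mult.left_commute)

lemma L2_inner_sum_left:
  assumes "\<And>e. e \<in> F \<Longrightarrow> f e \<in> L2 M" "k \<in> L2 M"
  shows "L2_inner M (\<lambda>x. \<Sum>e\<in>F. f e x) k = (\<Sum>e\<in>F. L2_inner M (f e) k)"
  unfolding L2_inner_def sum_distrib_right
  by (rule Bochner_Integration.integral_sum) (intro L2_integrable_mult_cnj assms)

lemma L2_norm_diff_square:
  assumes "f \<in> L2 M" "g \<in> L2 M"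
  shows "of_real ((L2_norm M (\<lambda>x. f x - g x))\<^sup>2) =
    L2_inner M f f - L2_inner M f g - (L2_inner M g f - L2_inner M g g)"
  using assms
  unfolding L2_inner_self[symmetric]
  by (simp add: L2_inner_diff_left L2_inner_diff_right L2_diff)

lemma L2_norm_eq_if_L2_inner_eq:
  assumes "u \<in> L2 M" "v \<in> L2 M" and inner_eq: "\<And>g. g \<in> L2 M \<Longrightarrow> L2_inner M u g = L2_inner M v g"
  shows "L2_norm M u = L2_norm M v"
proof -
  have "L2_inner M u u = cnj (L2_inner M u v)"
    using inner_eq[OF assms(1)] by (simp add: L2_inner_cnj)
  also have "\<dots> = cnj (L2_inner M v v)"
    using inner_eq[OF assms(2)] by simp
  also have "\<dots> = L2_inner M v v"
    by (rule L2_inner_cnj)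
  finally have "(L2_norm M u)\<^sup>2 = (L2_norm M v)\<^sup>2"
    unfolding L2_inner_self of_real_eq_iff .
  then show ?thesis by simp
qed

section \<open>Orthonormal families and the Hilbert--Schmidt norm\<close>

definition orthonormal :: "'a measure \<Rightarrow> ('a \<Rightarrow> complex) set \<Rightarrow> bool" where
  "orthonormal M E \<longleftrightarrow>
     E \<subseteq> L2 M \<and> (\<forall>e\<in>E. \<forall>e'\<in>E. L2_inner M e e' = (if e = e' then 1 else 0))"

lemma orthonormal_subset: "orthonormal M E \<Longrightarrow> F \<subseteq> E \<Longrightarrow> orthonormal M F"
  unfolding orthonormal_def by blast

lemma Bessel_inequality:
  assumes orthonormal_F: "finite F" "orthonormal M F" and f_L2: "f \<in> L2 M"
  shows "(\<Sum>e\<in>F. (cmod (L2_inner M f e))\<^sup>2) \<le> (L2_norm M f)\<^sup>2"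
proof -
  define c where "c e = L2_inner M f e" for e
  define p where "p x = (\<Sum>e\<in>F. c e * e x)" for x
  define S where "S = (\<Sum>e\<in>F. (cmod (c e))\<^sup>2)"
  have F_L2: "e \<in> L2 M" if "e \<in> F" for e
    using orthonormal_F(2) that by (auto simp: orthonormal_def)
  then have p_L2: "p \<in> L2 M"
    unfolding p_def by (intro L2_sum L2_cmult)
  have inner_p: "L2_inner M p g = (\<Sum>e\<in>F. c e * L2_inner M e g)" if "g \<in> L2 M" for g
    unfolding p_def using F_L2 that by (simp add: L2_inner_sum_left L2_cmult L2_inner_cmult_left)
  have square: "z * cnj z = of_real ((cmod z)\<^sup>2)" for z
    using complex_norm_square[of z] by simp
  have "L2_inner M p e = c e" if "e \<in> F" for e
  proof -
    have "L2_inner M p e = (\<Sum>e'\<in>F. if e' = e then c e' else 0)"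
      unfolding inner_p[OF F_L2[OF that]] using orthonormal_F(2) that
      by (intro sum.cong refl) (auto simp: orthonormal_def)
    then show ?thesis using orthonormal_F(1) that by simp
  qed
  then have inner_p_p: "L2_inner M p p = of_real S"
    unfolding inner_p[OF p_L2] S_def of_real_sum
    by (intro sum.cong refl) (simp add: L2_inner_cnj[of M p, symmetric] square)
  have inner_p_f: "L2_inner M p f = of_real S"
    unfolding inner_p[OF f_L2] S_def of_real_sum
    by (intro sum.cong refl) (simp add: L2_inner_cnj[of M f, symmetric] square flip: c_def)
  have inner_f_p: "L2_inner M f p = of_real S"
    using L2_inner_cnj[of M p f] inner_p_f by simp
  have "of_real ((L2_norm M (\<lambda>x. f x - p x))\<^sup>2) = (of_real ((L2_norm M f)\<^sup>2 - S) :: complex)"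
    unfolding L2_norm_diff_square[OF f_L2 p_L2] inner_f_p inner_p_f inner_p_p L2_inner_self[of M f]
    by simp
  then have "(L2_norm M (\<lambda>x. f x - p x))\<^sup>2 = (L2_norm M f)\<^sup>2 - S"
    unfolding of_real_eq_iff .
  then have "S \<le> (L2_norm M f)\<^sup>2" by (metis diff_ge_0_iff_ge zero_le_power2)
  then show ?thesis by (simp add: S_def c_def)
qed

lemma orthonormal_Union_chain:
  assumes "subset.chain {E. orthonormal M E} C"
  shows "orthonormal M (\<Union>C)"
proof -
  have "L2_inner M e e' = (if e = e' then 1 else 0)" if "e \<in> \<Union>C" "e' \<in> \<Union>C" for e e'
  proof -
    from that obtain X Y where "X \<in> C" "Y \<in> C" "e \<in> X" "e' \<in> Y" by auto
    moreover from this assms have "X \<subseteq> Y \<or> Y \<subseteq> X" by (meson subset_chain_def)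
    ultimately obtain Z where "Z \<in> C" "e \<in> Z" "e' \<in> Z" by blast
    with assms show ?thesis by (auto simp: orthonormal_def subset_chain_def)
  qed
  moreover have "\<Union>C \<subseteq> L2 M" using assms by (auto simp: orthonormal_def subset_chain_def)
  ultimately show ?thesis by (simp add: orthonormal_def)
qed

lemma orthonormal_extend:
  assumes orthonormal_E: "orthonormal M E"
    and f_orthogonal: "f \<in> L2 M" "\<And>e. e \<in> E \<Longrightarrow> L2_inner M f e = 0"
    and nonzero: "\<not> (AE x in M. f x = 0)"
  obtains g where "g \<notin> E" "orthonormal M (insert g E)"
proof -
  define r where "r = L2_norm M f"
  have r_nonzero: "r \<noteq> 0"
    using L2_norm_eq_0_AE[OF f_orthogonal(1)] nonzero by (auto simp: r_def)
  define g where "g x = of_real (1 / r) * f x" for x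
  have g_L2: "g \<in> L2 M" unfolding g_def by (intro L2_cmult f_orthogonal)
  have inner_g_g: "L2_inner M g g = 1"
    unfolding g_def L2_inner_cmult_left L2_inner_cmult_right
    using r_nonzero by (simp add: L2_inner_self power2_eq_square flip: r_def)
  have inner_g_e: "L2_inner M g e = 0" if "e \<in> E" for e
    unfolding g_def L2_inner_cmult_left using f_orthogonal(2)[OF that] by simp
  then have inner_e_g: "L2_inner M e g = 0" if "e \<in> E" for e
    using L2_inner_cnj[of M g e] that by simp
  have "g \<notin> E" using inner_g_g inner_g_e by auto
  moreover from this have "orthonormal M (insert g E)"
    using orthonormal_E g_L2 inner_g_g inner_g_e inner_e_g by (auto simp: orthonormal_def)
  ultimately show ?thesis by (rule that)
qed

lemma orthonormal_basis_exists: "\<exists>E. orthonormal_basis M E"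
proof -
  obtain E where orthonormal_E: "orthonormal M E" and maximal: "\<And>X. orthonormal M X \<Longrightarrow> E \<subseteq> X \<Longrightarrow> X = E"
    using subset_Zorn'[of "{E. orthonormal M E}"] orthonormal_Union_chain[of M] by auto
  have "AE x in M. f x = 0" if f_orthogonal: "f \<in> L2 M" "\<forall>e\<in>E. L2_inner M f e = 0" for f
  proof (rule ccontr)
    assume "\<not> (AE x in M. f x = 0)"
    then obtain g where "g \<notin> E" "orthonormal M (insert g E)"
      using orthonormal_extend[OF orthonormal_E f_orthogonal(1)] f_orthogonal(2) by blast
    then show False using maximal by blast
  qed
  with orthonormal_E have "orthonormal_basis M E"
    by (auto simp: orthonormal_basis_def orthonormal_def)
  then show ?thesis ..
qed

lemma HS_norm_nonneg: "0 \<le> HS_norm M T"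
  by (simp add: HS_norm_def Let_def infsum_nonneg)

lemma HS_norm_le:
  assumes sum_le: "\<And>F. finite F \<Longrightarrow> orthonormal M F \<Longrightarrow> (\<Sum>e\<in>F. (L2_norm M (T e))\<^sup>2) \<le> B"
  shows "HS_norm M T \<le> sqrt B"
proof -
  define E where "E = (SOME E. orthonormal_basis M E)"
  have "orthonormal_basis M E"
    unfolding E_def using orthonormal_basis_exists by (rule someI_ex)
  then have orthonormal_E: "orthonormal M E"
    by (simp add: orthonormal_basis_def orthonormal_def)
  have "0 \<le> B" using sum_le[of "{}"] by (simp add: orthonormal_def)
  have "(\<Sum>\<^sub>\<infinity>e\<in>E. (L2_norm M (T e))\<^sup>2) \<le> B"
  proof (cases "(\<lambda>e. (L2_norm M (T e))\<^sup>2) summable_on E")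
    case True
    then show ?thesis
      using sum_le orthonormal_subset[OF orthonormal_E] by (intro infsum_le_finite_sums) auto
  next
    case False
    then show ?thesis using \<open>0 \<le> B\<close> by (simp add: infsum_not_exists)
  qed
  then show ?thesis
    unfolding HS_norm_def E_def[symmetric] Let_def by simp
qed

definition integral_operator ::
    "'a measure \<Rightarrow> ('a \<Rightarrow> 'a \<Rightarrow> complex) \<Rightarrow> ('a \<Rightarrow> complex) \<Rightarrow> 'a \<Rightarrow> complex" where
  "integral_operator M K f y = (LINT x|M. K y x * f x)"

lemma (in sigma_finite_measure) borel_measurable_integral_operator:
  assumes "case_prod K \<in> borel_measurable (M \<Otimes>\<^sub>M M)" and "f \<in> borel_measurable M"
  shows "integral_operator M K f \<in> borel_measurable M"
proof -
  note [measurable] = assms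
  show ?thesis unfolding integral_operator_def by measurable
qed

lemma sum_integral_operator_le:
  assumes "finite F" "orthonormal M F" "K y \<in> L2 M"
  shows "(\<Sum>e\<in>F. (cmod (integral_operator M K e y))\<^sup>2) \<le> (L2_norm M (K y))\<^sup>2"
proof -
  have "integral_operator M K e y = cnj (L2_inner M (\<lambda>x. cnj (K y x)) e)" for e
    by (simp add: integral_operator_def L2_inner_def flip: Bochner_Integration.integral_cnj)
  then have "(\<Sum>e\<in>F. (cmod (integral_operator M K e y))\<^sup>2) \<le> (L2_norm M (\<lambda>x. cnj (K y x)))\<^sup>2"
    using Bessel_inequality[OF assms(1,2) L2_cnj[OF assms(3)]] by simp
  then show ?thesis by (simp add: L2_norm_def)
qed

lemma (in finite_measure) L2_bounded:
  assumes "f \<in> borel_measurable M" "\<And>x. cmod (f x) \<le> B"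
  shows "f \<in> L2 M"
  by (rule L2_finite_support[where A="space M" and B=B])
    (use assms in \<open>auto simp: less_top[symmetric]\<close>)

lemma (in finite_measure) integrable_L2_norm_kernel_square:
  assumes [measurable]: "case_prod K \<in> borel_measurable (M \<Otimes>\<^sub>M M)"
    and bounded: "\<And>y x. cmod (K y x) \<le> B"
  shows "integrable M (\<lambda>y. (L2_norm M (K y))\<^sup>2)"
proof (rule integrable_const_bound[where B="B\<^sup>2 * measure M (space M)"])
  have "0 \<le> B" using bounded order_trans norm_ge_zero by blast
  then have "(cmod (K y x))\<^sup>2 \<le> B\<^sup>2" for y x using bounded by (intro power_mono) auto
  then show "AE y in M. norm ((L2_norm M (K y))\<^sup>2) \<le> B\<^sup>2 * measure M (space M)"
    using integral_mono'[of M "\<lambda>_. B\<^sup>2"] by (simp add: L2_norm_square mult.commute)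
  show "(\<lambda>y. (L2_norm M (K y))\<^sup>2) \<in> borel_measurable M"
    unfolding L2_norm_square by measurable
qed

lemma (in finite_measure) HS_norm_integral_operator_le:
  assumes K_measurable [measurable]: "case_prod K \<in> borel_measurable (M \<Otimes>\<^sub>M M)"
    and bounded: "\<And>y x. cmod (K y x) \<le> B"
    and norm_T: "\<And>e. e \<in> L2 M \<Longrightarrow> L2_norm M (T e) = L2_norm M (integral_operator M K e)"
  shows "HS_norm M T \<le> sqrt (LINT y|M. (L2_norm M (K y))\<^sup>2)"
proof (rule HS_norm_le)
  fix F assume orthonormal_F: "finite F" "orthonormal M F"
  let ?u = "integral_operator M K"
  have K_L2: "K y \<in> L2 M" if "y \<in> space M" for y
    using that bounded by (intro L2_bounded) auto
  have norm_K: "integrable M (\<lambda>y. (L2_norm M (K y))\<^sup>2)"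
    using K_measurable bounded by (rule integrable_L2_norm_kernel_square)
  have bessel: "(\<Sum>e\<in>F. (cmod (?u e y))\<^sup>2) \<le> (L2_norm M (K y))\<^sup>2" if "y \<in> space M" for y
    using orthonormal_F K_L2[OF that] by (rule sum_integral_operator_le)
  have integrable_square: "integrable M (\<lambda>y. (cmod (?u e y))\<^sup>2)" if "e \<in> F" for e
  proof (rule Bochner_Integration.integrable_bound[OF norm_K])
    have "e \<in> borel_measurable M"
      using orthonormal_F that by (auto simp: orthonormal_def intro: L2_measurable)
    note [measurable] = borel_measurable_integral_operator[OF K_measurable this]
    show "(\<lambda>y. (cmod (?u e y))\<^sup>2) \<in> borel_measurable M" by measurable
    show "AE y in M. norm ((cmod (?u e y))\<^sup>2) \<le> norm ((L2_norm M (K y))\<^sup>2)"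
      using order_trans[OF member_le_sum[OF that] bessel] orthonormal_F by (intro AE_I2) auto
  qed
  have "(\<Sum>e\<in>F. (L2_norm M (T e))\<^sup>2) = (\<Sum>e\<in>F. LINT y|M. (cmod (?u e y))\<^sup>2)"
    using orthonormal_F norm_T
    by (intro sum.cong) (auto simp: orthonormal_def L2_norm_square subset_iff)
  also have "\<dots> = (LINT y|M. (\<Sum>e\<in>F. (cmod (?u e y))\<^sup>2))"
    using integrable_square by (simp add: Bochner_Integration.integral_sum)
  also have "\<dots> \<le> (LINT y|M. (L2_norm M (K y))\<^sup>2)"
    using integrable_square norm_K bessel
    by (intro integral_mono Bochner_Integration.integrable_sum)
  finally show "(\<Sum>e\<in>F. (L2_norm M (T e))\<^sup>2) \<le> (LINT y|M. (L2_norm M (K y))\<^sup>2)" .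
qed

section \<open>Surface measure\<close>

lemma nn_integral_lborel_affine:
  fixes f :: "'a::euclidean_space \<Rightarrow> ennreal"
  assumes [measurable]: "f \<in> borel_measurable borel" and "c \<noteq> 0"
  shows "(\<integral>\<^sup>+x. f x \<partial>lborel) = ennreal (\<bar>c\<bar> ^ DIM('a)) * (\<integral>\<^sup>+x. f (t + c *\<^sub>R x) \<partial>lborel)"
  by (subst lborel_affine[OF assms(2), of t])
    (simp add: nn_integral_density nn_integral_distr nn_integral_cmult)

lemma space_sphere_measure: "space sphere_measure = sphere 0 1"
  by (simp add: sphere_measure_def space_scale_measure)

lemma sets_sphere_measure: "sets sphere_measure = sets (restrict_space borel (sphere 0 1))"
  by (simp add: sphere_measure_def)

lemma measurable_ident_sphere_measure: "(\<lambda>\<theta>. \<theta>) \<in> sphere_measure \<rightarrow>\<^sub>M borel"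
  unfolding measurable_cong_sets[OF sets_sphere_measure refl]
  by (rule measurable_restrict_space1) simp

lemma borel_measurable_sphere_measure:
  "f \<in> borel_measurable borel \<Longrightarrow> f \<in> borel_measurable sphere_measure"
  by (rule measurable_compose[OF measurable_ident_sphere_measure])

lemma nn_integral_sphere_measure:
  fixes f :: "real^'n \<Rightarrow> ennreal"
  assumes [measurable]: "f \<in> borel_measurable borel"
  shows "(\<integral>\<^sup>+\<theta>. f \<theta> \<partial>sphere_measure) =
    of_nat CARD('n) * (\<integral>\<^sup>+x. f (x /\<^sub>R norm x) * indicator (ball 0 1 - {0}) x \<partial>lborel)"
proof -
  have normalize: "(\<lambda>x::real^'n. x /\<^sub>R norm x) \<in>
      restrict_space lborel (ball 0 1 - {0}) \<rightarrow>\<^sub>M restrict_space borel (sphere 0 1)"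
    by (intro measurable_restrict_space2 measurable_restrict_space1)
      (auto simp: space_restrict_space)
  have "f \<in> borel_measurable (restrict_space borel (sphere 0 1))"
    by (rule measurable_restrict_space1) simp
  then show ?thesis
    unfolding sphere_measure_def using normalize
    by (simp add: nn_integral_scale_measure nn_integral_distr nn_integral_restrict_space)
qed

lemma nn_integral_sphere_measure_less_top:
  fixes f :: "real^'n \<Rightarrow> ennreal"
  assumes "f \<in> borel_measurable borel" and f_le: "\<And>x. f x \<le> ennreal B"
  shows "(\<integral>\<^sup>+\<theta>. f \<theta> \<partial>sphere_measure) < \<infinity>"
proof -
  have "(\<integral>\<^sup>+x. f (x /\<^sub>R norm x) * indicator (ball 0 1 - {0}) x \<partial>lborel)
      \<le> (\<integral>\<^sup>+x. ennreal B * indicator (ball 0 1) (x::real^'n) \<partial>lborel)"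
    using f_le by (intro nn_integral_mono) (auto simp: indicator_def)
  also have "\<dots> < \<infinity>"
    using emeasure_lborel_ball_finite[of "0::real^'n" 1]
    by (simp add: nn_integral_cmult_indicator ennreal_mult_less_top)
  finally show ?thesis
    using assms(1) by (simp add: nn_integral_sphere_measure ennreal_mult_less_top of_nat_less_top)
qed

lemma finite_measure_sphere_measure: "finite_measure (sphere_measure :: (real^'n) measure)"
proof
  show "emeasure (sphere_measure :: (real^'n) measure) (space sphere_measure) \<noteq> \<infinity>"
    using nn_integral_sphere_measure_less_top[of "\<lambda>_::real^'n. 1" 1] by simp
qed

interpretation sphere_measure: finite_measure "sphere_measure :: (real^'n) measure"
  by (rule finite_measure_sphere_measure)

lemma nn_integral_homogeneous_ball:
  fixes f :: "real^'n \<Rightarrow> ennreal"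
  assumes [measurable]: "f \<in> borel_measurable borel" and "R > 0"
  shows "(\<integral>\<^sup>+x. f (x /\<^sub>R norm x) * indicator (ball 0 R - {0}) x \<partial>lborel) =
    ennreal (R ^ CARD('n)) * (\<integral>\<^sup>+x. f (x /\<^sub>R norm x) * indicator (ball 0 1 - {0}) x \<partial>lborel)"
proof -
  have [measurable]: "ball 0 R - {0 :: real^'n} \<in> sets borel" by simp
  have "f ((0 + R *\<^sub>R x) /\<^sub>R norm (0 + R *\<^sub>R x)) * indicator (ball 0 R - {0}) (0 + R *\<^sub>R x) =
      f (x /\<^sub>R norm x) * indicator (ball 0 1 - {0}) x" for x
  proof -
    have "(0 + R *\<^sub>R x) /\<^sub>R norm (0 + R *\<^sub>R x) = x /\<^sub>R norm x"
      using assms(2) by simp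
    then show ?thesis
      using assms(2) by (simp only:) (auto simp: indicator_def)
  qed
  then show ?thesis
    using assms(2)
    by (subst nn_integral_lborel_affine[of _ R 0]) (simp_all only: DIM_cart, measurable, simp_all)
qed

text \<open>
  For \<open>f\<close> homogeneous of degree \<open>0\<close>, the integral over the shell is \<open>((1 + \<delta>)\<^bsup>n\<^esup> - 1) / n\<close> times the
  integral over the sphere.
\<close>

lemma nn_integral_sphere_measure_le_shell:
  fixes f :: "real^'n \<Rightarrow> ennreal"
  assumes f_measurable [measurable]: "f \<in> borel_measurable borel"
    and finite: "(\<integral>\<^sup>+\<theta>. f \<theta> \<partial>sphere_measure) < \<infinity>" and "\<delta> > 0"
  shows "ennreal \<delta> * (\<integral>\<^sup>+\<theta>. f \<theta> \<partial>sphere_measure) \<le>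
    (\<integral>\<^sup>+x. f (x /\<^sub>R norm x) * indicator (ball 0 (1 + \<delta>) - ball 0 1) x \<partial>lborel)"
    (is "_ \<le> ?shell")
proof -
  let ?n = "CARD('n)"
  define J where "J R = (\<integral>\<^sup>+x. f (x /\<^sub>R norm x) * indicator (ball 0 R - {0}) x \<partial>lborel)" for R
  have sphere: "(\<integral>\<^sup>+\<theta>. f \<theta> \<partial>sphere_measure) = of_nat ?n * J 1"
    unfolding J_def by (rule nn_integral_sphere_measure[OF f_measurable])
  then obtain j where J_1: "J 1 = ennreal j" "0 \<le> j"
    using finite by (cases "J 1") (auto simp: ennreal_mult_eq_top_iff)
  have Bernoulli: "1 + real ?n * \<delta> \<le> (1 + \<delta>) ^ ?n"
    using \<open>\<delta> > 0\<close> by (intro Bernoulli_inequality) simp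
  have "J 1 + ennreal \<delta> * (of_nat ?n * J 1) = ennreal ((1 + real ?n * \<delta>) * j)"
    using J_1 \<open>\<delta> > 0\<close>
    by (simp add: ennreal_of_nat_eq_real_of_nat algebra_simps flip: ennreal_mult ennreal_plus)
  also have "\<dots> \<le> ennreal ((1 + \<delta>) ^ ?n * j)"
    using Bernoulli J_1(2) by (intro ennreal_leI mult_right_mono)
  also have "\<dots> = J (1 + \<delta>)"
    using J_1 \<open>\<delta> > 0\<close> nn_integral_homogeneous_ball[OF f_measurable, of "1 + \<delta>"]
    by (simp add: J_def ennreal_mult)
  also have "\<dots> = J 1 + ?shell"
    unfolding J_def using \<open>\<delta> > 0\<close>
    by (subst nn_integral_add[symmetric]) (auto intro!: nn_integral_cong simp: indicator_def)
  finally show ?thesis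
    unfolding sphere using J_1 by (simp add: ennreal_add_left_cancel_le)
qed

section \<open>Cauchy weights\<close>

lemma prod_Basis_cart: "(\<Prod>b\<in>(Basis :: (real^'n) set). g b) = (\<Prod>i\<in>UNIV. g (axis i 1))"
proof -
  have Basis: "(Basis :: (real^'n) set) = range (\<lambda>i. axis i 1)" by (auto simp: Basis_vec_def)
  have "inj (\<lambda>i. axis i 1 :: real^'n)" by (auto simp: inj_on_def axis_eq_axis)
  then show ?thesis unfolding Basis by (simp add: prod.reindex)
qed

lemma nn_integral_lborel_cart_prod:
  fixes f :: "'n::finite \<Rightarrow> real \<Rightarrow> ennreal"
  assumes "\<And>i. f i \<in> borel_measurable borel"
  shows "(\<integral>\<^sup>+x. (\<Prod>i\<in>UNIV. f i ((x::real^'n) $ i)) \<partial>lborel) = (\<Prod>i\<in>UNIV. \<integral>\<^sup>+t. f i t \<partial>lborel)"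
  using nn_integral_lborel_prod[of "\<lambda>b::real^'n. f (axis_index b)"] assms
  by (simp add: prod_Basis_cart inner_axis)

lemma nn_integral_inverse_1_plus_square: "(\<integral>\<^sup>+x. ennreal (inverse (1 + x\<^sup>2)) \<partial>lborel) = ennreal pi"
  using integrable_inverse_1_plus_square LBINT_inverse_1_plus_square
  by (subst nn_integral_eq_integral)
    (auto simp: set_integrable_def interval_lebesgue_integral_def set_lebesgue_integral_def)

definition cauchy_weight :: "real^'n::finite \<Rightarrow> real" where
  "cauchy_weight x = (\<Prod>i\<in>UNIV. inverse (1 + (x $ i)\<^sup>2))"

lemma cauchy_weight_nonneg: "0 \<le> cauchy_weight x"
  unfolding cauchy_weight_def by (intro prod_nonneg) auto

lemma cauchy_weight_le_1: "cauchy_weight x \<le> 1"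
  unfolding cauchy_weight_def by (intro prod_le_1) (auto simp: inverse_le_1_iff)

lemma borel_measurable_cauchy_weight [measurable]: "cauchy_weight \<in> borel_measurable borel"
  unfolding cauchy_weight_def by measurable

lemma nn_integral_cauchy_weight:
  fixes y :: "real^'n"
  assumes "\<kappa> > 0"
  shows "(\<integral>\<^sup>+x. ennreal (cauchy_weight (\<kappa> *\<^sub>R (x - y))) \<partial>lborel) = ennreal ((pi / \<kappa>) ^ CARD('n))"
proof -
  have "(\<integral>\<^sup>+x. ennreal (cauchy_weight (\<kappa> *\<^sub>R (x - y))) \<partial>lborel) =
      ennreal ((1 / \<kappa>) ^ CARD('n)) * (\<integral>\<^sup>+x. ennreal (cauchy_weight (x::real^'n)) \<partial>lborel)"
    using assms by (subst nn_integral_lborel_affine[of _ "1 / \<kappa>" y]) auto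
  also have "(\<integral>\<^sup>+x. ennreal (cauchy_weight (x::real^'n)) \<partial>lborel) =
      (\<integral>\<^sup>+x. (\<Prod>i\<in>UNIV. ennreal (inverse (1 + ((x::real^'n) $ i)\<^sup>2))) \<partial>lborel)"
    by (simp add: cauchy_weight_def prod_ennreal)
  also have "\<dots> = ennreal (pi ^ CARD('n))"
    by (subst nn_integral_lborel_cart_prod)
      (simp_all add: nn_integral_inverse_1_plus_square ennreal_power)
  finally show ?thesis
    using assms by (simp add: power_mult_distrib[symmetric] flip: ennreal_mult)
qed

lemma cauchy_weight_Harnack:
  fixes x y :: "real^'n"
  assumes "norm (x - y) \<le> 1"
  shows "cauchy_weight y \<le> 3 ^ CARD('n) * cauchy_weight x"
proof -
  have "inverse (1 + (y $ i)\<^sup>2) \<le> 3 * inverse (1 + (x $ i)\<^sup>2)" for i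
  proof -
    define d where "d = x $ i - y $ i"
    have "\<bar>d\<bar> \<le> 1"
      using component_le_norm_cart[of "x - y" i] assms by (simp add: d_def)
    then have "d\<^sup>2 \<le> 1" by (simp add: abs_square_le_1)
    moreover have "(x $ i)\<^sup>2 = d\<^sup>2 + (y $ i)\<^sup>2 + 2 * d * y $ i"
      by (simp add: d_def power2_eq_square algebra_simps)
    ultimately have "1 + (x $ i)\<^sup>2 \<le> 3 * (1 + (y $ i)\<^sup>2)"
      using sum_squares_bound[of d "y $ i"] zero_le_power2[of "y $ i"]
      unfolding distrib_left by linarith
    moreover have "0 < 1 + (x $ i)\<^sup>2" "0 < 1 + (y $ i)\<^sup>2" by (auto intro: add_pos_nonneg)
    ultimately show ?thesis by (simp add: field_simps)
  qed
  then have "cauchy_weight y \<le> (\<Prod>i\<in>(UNIV::'n set). 3 * inverse (1 + (x $ i)\<^sup>2))"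
    unfolding cauchy_weight_def by (intro prod_mono) auto
  then show ?thesis by (simp only: cauchy_weight_def prod.distrib prod_constant)
qed

lemma norm_diff_normalize:
  fixes x :: "'a::real_normed_vector"
  assumes "1 \<le> norm x"
  shows "norm (x - x /\<^sub>R norm x) = norm x - 1"
proof -
  have "x - x /\<^sub>R norm x = (1 - inverse (norm x)) *\<^sub>R x" by (simp add: scaleR_left_diff_distrib)
  moreover have "0 \<le> 1 - inverse (norm x)" using assms by (simp add: inverse_le_1_iff)
  moreover have "norm x \<noteq> 0" using assms by linarith
  ultimately show ?thesis by (simp add: left_diff_distrib)
qed

text \<open>The weight is essentially constant across a shell of width \<open>1/\<kappa>\<close> around the unit sphere.\<close>

lemma nn_integral_sphere_cauchy_weight_le:
  fixes y :: "real^'n"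
  assumes "\<kappa> > 0"
  shows "(\<integral>\<^sup>+\<theta>. ennreal (cauchy_weight (\<kappa> *\<^sub>R (\<theta> - y))) \<partial>sphere_measure) \<le>
      ennreal (\<kappa> * (3 * pi / \<kappa>) ^ CARD('n))"
proof -
  let ?n = "CARD('n)" and ?w = "\<lambda>x. cauchy_weight (\<kappa> *\<^sub>R (x - y))"
  let ?I = "\<integral>\<^sup>+\<theta>. ennreal (?w \<theta>) \<partial>sphere_measure"
  have shell: "ennreal (?w (x /\<^sub>R norm x)) \<le> ennreal (3 ^ ?n * ?w x)"
    if "x \<in> ball 0 (1 + 1 / \<kappa>) - ball 0 1" for x
  proof (intro ennreal_leI cauchy_weight_Harnack)
    have "norm (x - x /\<^sub>R norm x) \<le> 1 / \<kappa>"
      using that norm_diff_normalize[of x] by auto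
    then have "\<kappa> * norm (x - x /\<^sub>R norm x) \<le> 1" using assms by (simp add: field_simps)
    moreover have "\<kappa> *\<^sub>R (x - y) - \<kappa> *\<^sub>R (x /\<^sub>R norm x - y) = \<kappa> *\<^sub>R (x - x /\<^sub>R norm x)"
      by (simp add: algebra_simps)
    ultimately show "norm (\<kappa> *\<^sub>R (x - y) - \<kappa> *\<^sub>R (x /\<^sub>R norm x - y)) \<le> 1"
      using assms by simp
  qed
  have "?I < \<infinity>"
    by (rule nn_integral_sphere_measure_less_top[where B=1])
      (auto intro: ennreal_leI cauchy_weight_le_1)
  then have "ennreal (1 / \<kappa>) * ?I \<le>
      (\<integral>\<^sup>+x. ennreal (?w (x /\<^sub>R norm x)) * indicator (ball 0 (1 + 1 / \<kappa>) - ball 0 1) x \<partial>lborel)"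
    using assms by (intro nn_integral_sphere_measure_le_shell) auto
  also have "\<dots> \<le> (\<integral>\<^sup>+x. ennreal (3 ^ ?n) * ennreal (?w x) \<partial>lborel)"
    using shell
    by (intro nn_integral_mono) (auto simp: indicator_def ennreal_mult cauchy_weight_nonneg)
  also have "\<dots> = ennreal ((3 * pi / \<kappa>) ^ ?n)"
    using assms
    by (simp add: nn_integral_cmult nn_integral_cauchy_weight power_mult_distrib[symmetric]
        flip: ennreal_mult)
  finally have "ennreal \<kappa> * (ennreal (1 / \<kappa>) * ?I) \<le> ennreal \<kappa> * ennreal ((3 * pi / \<kappa>) ^ ?n)"
    by (rule mult_left_mono) simp
  then show ?thesis
    using assms by (simp add: mult.assoc[symmetric] flip: ennreal_mult)
qed

lemma
  fixes y :: "real^'n"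
  assumes "\<kappa> > 0"
  shows integrable_sphere_cauchy_weight:
      "integrable sphere_measure (\<lambda>\<theta>. cauchy_weight (\<kappa> *\<^sub>R (\<theta> - y)))"
    and integral_sphere_cauchy_weight_le:
      "(LINT \<theta>|sphere_measure. cauchy_weight (\<kappa> *\<^sub>R (\<theta> - y))) \<le> \<kappa> * (3 * pi / \<kappa>) ^ CARD('n)"
proof -
  show integrable: "integrable sphere_measure (\<lambda>\<theta>. cauchy_weight (\<kappa> *\<^sub>R (\<theta> - y)))"
    by (intro sphere_measure.integrable_const_bound[where B=1] borel_measurable_sphere_measure
        AE_I2)
      (simp_all add: cauchy_weight_nonneg cauchy_weight_le_1)
  have "ennreal (LINT \<theta>|sphere_measure. cauchy_weight (\<kappa> *\<^sub>R (\<theta> - y))) \<le>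
      ennreal (\<kappa> * (3 * pi / \<kappa>) ^ CARD('n))"
    using nn_integral_sphere_cauchy_weight_le[OF assms]
    by (subst nn_integral_eq_integral[symmetric]) (auto simp: integrable cauchy_weight_nonneg)
  then show "(LINT \<theta>|sphere_measure. cauchy_weight (\<kappa> *\<^sub>R (\<theta> - y))) \<le> \<kappa> * (3 * pi / \<kappa>) ^ CARD('n)"
    using assms by (subst (asm) ennreal_le_iff) auto
qed

section \<open>The Fourier transform\<close>

lemma borel_measurable_cis [measurable]:
  assumes [measurable]: "f \<in> borel_measurable M"
  shows "(\<lambda>x. cis (f x)) \<in> borel_measurable M"
  by (rule borel_measurable_continuous_on[of cis]) (auto intro: continuous_intros)

definition fourier :: "('a::euclidean_space \<Rightarrow> complex) \<Rightarrow> 'a \<Rightarrow> complex" where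
  "fourier f \<xi> = (LINT x|lborel. f x * cis (\<xi> \<bullet> x))"

lemma integrable_mult_cis:
  assumes "integrable M f" "g \<in> borel_measurable M"
  shows "integrable M (\<lambda>x. f x * cis (g x))"
  using assms by (intro Bochner_Integration.integrable_bound[OF assms(1)]) (auto simp: norm_mult)

lemma fourier_cmult: "fourier (\<lambda>x. c * f x) \<xi> = c * fourier f \<xi>"
  by (simp add: fourier_def mult.assoc)

lemma norm_fourier_le: "cmod (fourier f \<xi>) \<le> (LINT x|lborel. cmod (f x))"
  unfolding fourier_def by (rule order_trans[OF integral_norm_bound]) (simp add: norm_mult)

lemma borel_measurable_fourier:
  assumes "f \<in> borel_measurable borel"
  shows "fourier f \<in> borel_measurable borel"
proof -
  note [measurable] = assms
  show ?thesis unfolding fourier_def by measurable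
qed

section \<open>The kernel of the operator\<close>

lemma (in pair_sigma_finite) Fubini_bounded_kernel:
  fixes f g :: "_ \<Rightarrow> complex"
  assumes f_integrable: "integrable M1 f" and g_integrable: "integrable M2 g"
    and k_measurable: "case_prod k \<in> borel_measurable (M1 \<Otimes>\<^sub>M M2)"
    and bounded: "\<And>x y. cmod (k x y) \<le> B"
  shows "(LINT x|M1. f x * (LINT y|M2. k x y * g y)) = (LINT y|M2. (LINT x|M1. f x * k x y) * g y)"
proof -
  note [measurable] = borel_measurable_integrable[OF f_integrable]
    borel_measurable_integrable[OF g_integrable] k_measurable
  have "0 \<le> B" using bounded norm_ge_zero order_trans by blast
  have "integrable (M1 \<Otimes>\<^sub>M M2) (\<lambda>z. of_real B * (f (fst z) * g (snd z)))"
    by (intro integrable_mult_right Fubini_integrable)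
      (use f_integrable g_integrable in \<open>auto simp: norm_mult\<close>)
  then have "integrable (M1 \<Otimes>\<^sub>M M2) (\<lambda>(x, y). f x * k x y * g y)"
  proof (rule Bochner_Integration.integrable_bound)
    have "cmod (f x) * cmod (k x y) * cmod (g y) \<le> B * (cmod (f x) * cmod (g y))" for x y
      using mult_right_mono[OF bounded[of x y], of "cmod (f x) * cmod (g y)"] by (simp add: mult_ac)
    then show "AE z in M1 \<Otimes>\<^sub>M M2. norm (case z of (x, y) \<Rightarrow> f x * k x y * g y)
        \<le> norm (of_real B * (f (fst z) * g (snd z)))"
      using \<open>0 \<le> B\<close> by (auto simp: norm_mult)
    show "(\<lambda>(x, y). f x * k x y * g y) \<in> borel_measurable (M1 \<Otimes>\<^sub>M M2)" by measurable
  qed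
  from Fubini_integral[OF this] show ?thesis by (simp add: mult.assoc flip: integral_mult_left_zero)
qed

lemma (in finite_measure) L2_integrable:
  assumes "f \<in> L2 M"
  shows "integrable M f"
proof (rule Bochner_Integration.integrable_bound)
  show "integrable M (\<lambda>x. 1 + (cmod (f x))\<^sup>2)"
    using assms by (auto simp: L2_def)
  show "f \<in> borel_measurable M" using assms by (rule L2_measurable)
  have "t \<le> 1 + t\<^sup>2" for t :: real
    using sum_squares_bound[of t 1, simplified] zero_le_power2[of t] by linarith
  then show "AE x in M. norm (f x) \<le> norm (1 + (cmod (f x))\<^sup>2)"
    by (simp add: abs_of_nonneg)
qed

lemma (in finite_measure) L2_norm_le:
  assumes "\<And>x. x \<in> space M \<Longrightarrow> cmod (f x) \<le> B" and "0 \<le> B"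
  shows "L2_norm M f \<le> B * sqrt (measure M (space M))"
proof -
  have "(LINT x|M. (cmod (f x))\<^sup>2) \<le> (LINT x|M. B\<^sup>2)"
    using assms by (intro integral_mono' power_mono) auto
  then have "L2_norm M f \<le> sqrt (B\<^sup>2 * measure M (space M))"
    unfolding L2_norm_def by (intro real_sqrt_le_mono) (simp add: mult.commute)
  then show ?thesis using assms(2) by (simp add: real_sqrt_mult)
qed

definition F_kernel :: "real \<Rightarrow> (real^'n::finite \<Rightarrow> complex) \<Rightarrow> real^'n \<Rightarrow> real^'n \<Rightarrow> complex" where
  "F_kernel \<kappa> h y \<theta> =
     of_real (\<kappa> powr ((real CARD('n) - 1) / 2)) * fourier h (\<kappa> *\<^sub>R (\<theta> - y))"

lemma F_kernel_cmult: "F_kernel \<kappa> (\<lambda>x. c * h x) y = (\<lambda>\<theta>. c * F_kernel \<kappa> h y \<theta>)"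
  by (simp add: F_kernel_def fourier_cmult fun_eq_iff)

lemma norm_F_kernel_le:
  fixes h :: "real^'n \<Rightarrow> complex"
  shows "cmod (F_kernel \<kappa> h y \<theta>) \<le> \<kappa> powr ((real CARD('n) - 1) / 2) * (LINT x|lborel. cmod (h x))"
  unfolding F_kernel_def norm_mult by (intro mult_mono norm_fourier_le) auto

lemma borel_measurable_F_kernel:
  fixes h :: "real^'n \<Rightarrow> complex"
  assumes "h \<in> borel_measurable borel"
  shows "case_prod (F_kernel \<kappa> h) \<in> borel_measurable (sphere_measure \<Otimes>\<^sub>M sphere_measure)"
proof -
  note [measurable] = borel_measurable_fourier[OF assms] measurable_ident_sphere_measure
  show ?thesis unfolding F_kernel_def by measurable
qed

lemma P_op_cis: "P_op \<kappa> f x = (LINT \<theta>|sphere_measure. cis (\<kappa> * (\<theta> \<bullet> x)) * f \<theta>)"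
  by (simp add: P_op_def cis_conv_exp)

lemma norm_P_op_le: "cmod (P_op \<kappa> f x) \<le> (LINT \<theta>|sphere_measure. cmod (f \<theta>))"
  unfolding P_op_cis by (rule order_trans[OF integral_norm_bound]) (simp add: norm_mult)

lemma borel_measurable_P_op:
  assumes "f \<in> borel_measurable sphere_measure"
  shows "P_op \<kappa> f \<in> borel_measurable borel"
proof -
  note [measurable] = assms measurable_ident_sphere_measure
  show ?thesis unfolding P_op_cis by measurable
qed

lemma integrable_mult_P_op:
  assumes h_integrable: "integrable lborel h"
    and f_measurable: "f \<in> borel_measurable sphere_measure"
  shows "integrable lborel (\<lambda>x. h x * P_op \<kappa> f x)"
proof (rule Bochner_Integration.integrable_bound)
  let ?B = "LINT \<theta>|sphere_measure. cmod (f \<theta>)"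
  show "integrable lborel (\<lambda>x. of_real ?B * h x)" using h_integrable by simp
  show "AE x in lborel. norm (h x * P_op \<kappa> f x) \<le> norm (of_real ?B * h x)"
    by (auto intro!: AE_I2 mult_left_mono norm_P_op_le simp: norm_mult mult.commute)
  show "(\<lambda>x. h x * P_op \<kappa> f x) \<in> borel_measurable lborel"
    using h_integrable borel_measurable_P_op[OF f_measurable, of \<kappa>] by simp
qed

context
  fixes h :: "real^'n \<Rightarrow> complex" and \<kappa> :: real
  assumes h_integrable: "integrable lborel h"
begin

interpretation pair_sigma_finite
  "lborel :: (real^'n) measure" "sphere_measure :: (real^'n) measure" ..

lemma integral_operator_F_kernel:
  assumes f_integrable: "integrable sphere_measure f"
  shows "integral_operator sphere_measure (F_kernel \<kappa> h) f y =
    of_real (\<kappa> powr ((real CARD('n) - 1) / 2)) *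
      (LINT x|lborel. h x * P_op \<kappa> f x * cis (- \<kappa> * (y \<bullet> x)))"
    (is "_ = ?c * _")
proof -
  note [measurable] = measurable_ident_sphere_measure
  have "cis (\<kappa> *\<^sub>R (\<theta> - y) \<bullet> x) = cis (- \<kappa> * (y \<bullet> x)) * cis (\<kappa> * (\<theta> \<bullet> x))" for \<theta> x
    by (simp add: cis_mult inner_diff_left algebra_simps)
  then have "integral_operator sphere_measure (F_kernel \<kappa> h) f y = ?c *
      (LINT \<theta>|sphere_measure.
        (LINT x|lborel. (h x * cis (- \<kappa> * (y \<bullet> x))) * cis (\<kappa> * (\<theta> \<bullet> x))) * f \<theta>)"
    by (simp add: integral_operator_def F_kernel_def fourier_def mult.assoc)
  also have "\<dots> = ?c * (LINT x|lborel. (h x * cis (- \<kappa> * (y \<bullet> x))) * P_op \<kappa> f x)"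
    unfolding P_op_cis using h_integrable f_integrable
    by (subst Fubini_bounded_kernel[where B=1]) (auto intro: integrable_mult_cis)
  finally show ?thesis by (simp add: mult_ac)
qed

lemma L2_inner_integral_operator_F_kernel:
  assumes f_integrable: "integrable sphere_measure f"
    and g_integrable: "integrable sphere_measure g"
  shows "L2_inner sphere_measure (integral_operator sphere_measure (F_kernel \<kappa> h) f) g =
    of_real (\<kappa> powr ((real CARD('n) - 1) / 2)) *
      (LINT x|lborel. h x * P_op \<kappa> f x * cnj (P_op \<kappa> g x))"
    (is "_ = ?c * _")
proof -
  note [measurable] = measurable_ident_sphere_measure
  have "L2_inner sphere_measure (integral_operator sphere_measure (F_kernel \<kappa> h) f) g = ?c *
      (LINT y|sphere_measure.
        (LINT x|lborel. (h x * P_op \<kappa> f x) * cis (- \<kappa> * (y \<bullet> x))) * cnj (g y))"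
    by (simp add: L2_inner_def integral_operator_F_kernel[OF f_integrable] mult.assoc)
  also have "\<dots> = ?c *
      (LINT x|lborel. (h x * P_op \<kappa> f x) *
        (LINT y|sphere_measure. cis (- \<kappa> * (y \<bullet> x)) * cnj (g y)))"
    using h_integrable f_integrable g_integrable
    by (subst Fubini_bounded_kernel[where B=1]) (auto intro: integrable_mult_P_op)
  also have "(\<lambda>x. LINT y|sphere_measure. cis (- \<kappa> * (y \<bullet> x)) * cnj (g y)) = (\<lambda>x. cnj (P_op \<kappa> g x))"
    by (simp add: P_op_cis cis_cnj flip: Bochner_Integration.integral_cnj)
  finally show ?thesis .
qed

lemma integral_operator_F_kernel_L2:
  assumes f_integrable: "integrable sphere_measure f"
  shows "integral_operator sphere_measure (F_kernel \<kappa> h) f \<in> L2 sphere_measure"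
proof (rule sphere_measure.L2_bounded)
  show "integral_operator sphere_measure (F_kernel \<kappa> h) f \<in> borel_measurable sphere_measure"
    using h_integrable f_integrable
    by (intro sphere_measure.borel_measurable_integral_operator borel_measurable_F_kernel) auto
  show "cmod (integral_operator sphere_measure (F_kernel \<kappa> h) f y) \<le>
      \<kappa> powr ((real CARD('n) - 1) / 2) * (LINT x|lborel. cmod (h x * P_op \<kappa> f x))" for y
    unfolding integral_operator_F_kernel[OF f_integrable] norm_mult
    by (intro mult_mono order_trans[OF integral_norm_bound]) (auto simp: norm_mult)
qed

lemma L2_norm_F_op:
  assumes support: "\<And>x. x \<notin> ball 0 1 \<Longrightarrow> h x = 0" and f_L2: "f \<in> L2 sphere_measure"
  shows "L2_norm sphere_measure (F_op \<kappa> h f) =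
    L2_norm sphere_measure (integral_operator sphere_measure (F_kernel \<kappa> h) f)"
proof -
  let ?u = "integral_operator sphere_measure (F_kernel \<kappa> h) f"
  let ?rhs = "\<lambda>g. of_real (\<kappa> powr ((real CARD('n) - 1) / 2)) *
    (LINT x:ball 0 1|lborel. h x * P_op \<kappa> f x * cnj (P_op \<kappa> g x))"
  note f_integrable = sphere_measure.L2_integrable[OF f_L2]
  have inner_rhs: "L2_inner sphere_measure ?u g = ?rhs g" if "g \<in> L2 sphere_measure" for g
  proof -
    have "(LINT x:ball 0 1|lborel. h x * P_op \<kappa> f x * cnj (P_op \<kappa> g x)) =
        (LINT x|lborel. h x * P_op \<kappa> f x * cnj (P_op \<kappa> g x))"
      unfolding set_lebesgue_integral_def
      by (rule Bochner_Integration.integral_cong) (auto simp: indicator_def support)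
    then show ?thesis
      using L2_inner_integral_operator_F_kernel[OF f_integrable]
        sphere_measure.L2_integrable[OF that]
      by simp
  qed
  have "F_op \<kappa> h f \<in> L2 sphere_measure \<and>
      (\<forall>g\<in>L2 sphere_measure. L2_inner sphere_measure (F_op \<kappa> h f) g = ?rhs g)"
    unfolding F_op_def
    by (rule someI[of _ ?u]) (use inner_rhs integral_operator_F_kernel_L2[OF f_integrable] in auto)
  then show ?thesis
    using inner_rhs integral_operator_F_kernel_L2[OF f_integrable]
    by (intro L2_norm_eq_if_L2_inner_eq) auto
qed

lemma HS_norm_F_op_le:
  assumes "\<And>x. x \<notin> ball 0 1 \<Longrightarrow> h x = 0"
  shows "HS_norm sphere_measure (F_op \<kappa> h) \<le>
    sqrt (LINT y|sphere_measure. (L2_norm sphere_measure (F_kernel \<kappa> h y))\<^sup>2)"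
  using h_integrable norm_F_kernel_le L2_norm_F_op[OF assms]
  by (intro sphere_measure.HS_norm_integral_operator_le borel_measurable_F_kernel) auto

end

lemma HS_norm_F_op_cmult_le:
  fixes h :: "real^'n \<Rightarrow> complex"
  assumes h_support: "integrable lborel h" "\<And>x. x \<notin> ball 0 1 \<Longrightarrow> h x = 0"
    and kernel_le: "\<And>y. y \<in> sphere 0 1 \<Longrightarrow> L2_norm sphere_measure (F_kernel \<kappa> h y) \<le> C" "0 \<le> C"
  shows "HS_norm sphere_measure (F_op \<kappa> (\<lambda>x. c * h x)) \<le>
    cmod c * C * sqrt (measure (sphere_measure :: (real^'n) measure) (sphere 0 1))"
proof -
  let ?N = "\<lambda>y. L2_norm sphere_measure (F_kernel \<kappa> (\<lambda>x. c * h x) y)"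
  have "HS_norm sphere_measure (F_op \<kappa> (\<lambda>x. c * h x)) \<le> L2_norm sphere_measure (\<lambda>y. of_real (?N y))"
    using HS_norm_F_op_le[of "\<lambda>x. c * h x" \<kappa>] h_support
    by (simp add: L2_norm_def[of _ "\<lambda>y. of_real (?N y)"])
  also have "\<dots> \<le>
      (cmod c * C) * sqrt (measure sphere_measure (space (sphere_measure :: (real^'n) measure)))"
    using kernel_le by (intro sphere_measure.L2_norm_le)
      (auto simp: F_kernel_cmult L2_norm_cmult norm_mult space_sphere_measure
        intro!: mult_left_mono)
  finally show ?thesis by (simp add: space_sphere_measure)
qed

section \<open>Smooth bumps\<close>

definition flat :: "real poly \<Rightarrow> real \<Rightarrow> real" where
  "flat p x = (if x > 0 then poly p (1 / x) * exp (- (1 / x)) else 0)"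

lemma flat_1_nonneg: "0 \<le> flat 1 x" and flat_1_le_1: "flat 1 x \<le> 1"
  by (auto simp: flat_def)

lemma poly_times_exp_minus_tendsto_0: "((\<lambda>y. poly p y * exp (- y)) \<longlongrightarrow> (0::real)) at_top"
proof -
  have "((\<lambda>y. \<Sum>i\<le>degree p. coeff p i * (y ^ i / exp y)) \<longlongrightarrow> (\<Sum>i\<le>degree p. coeff p i * 0)) at_top"
    by (intro tendsto_intros tendsto_power_div_exp_0)
  then show ?thesis
    by (simp add: poly_altdef sum_distrib_right exp_minus divide_inverse mult.assoc)
qed

lemma flat_tendsto_0: "(flat p \<longlongrightarrow> 0) (at 0)"
proof (rule filterlim_split_at)
  have "((\<lambda>x. poly p (inverse x) * exp (- inverse x)) \<longlongrightarrow> 0) (at_right 0)"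
    by (rule filterlim_compose[OF poly_times_exp_minus_tendsto_0 filterlim_inverse_at_top_right])
  then show "(flat p \<longlongrightarrow> 0) (at_right 0)"
    by (rule Lim_transform_eventually) (auto simp: flat_def eventually_at_filter inverse_eq_divide)
  show "(flat p \<longlongrightarrow> 0) (at_left 0)"
    by (rule Lim_transform_eventually[OF tendsto_const]) (auto simp: flat_def eventually_at_filter)
qed

lemma flat_has_real_derivative:
  "(flat p has_real_derivative flat (monom 1 2 * (p - pderiv p)) x) (at x)"
proof -
  consider "x = 0" | "x > 0" | "x < 0" by linarith
  then show ?thesis
  proof cases
    assume "x = 0"
    have "(\<lambda>h. (flat p (0 + h) - flat p 0) / h) = flat (pCons 0 p)"
      by (auto simp: flat_def fun_eq_iff field_simps)
    then show ?thesis
      using flat_tendsto_0[of "pCons 0 p"] \<open>x = 0\<close> unfolding has_field_derivative_iff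
      by (simp add: flat_def)
  next
    assume "x > 0"
    have "((\<lambda>x. poly p (1 / x) * exp (- (1 / x))) has_real_derivative
        flat (monom 1 2 * (p - pderiv p)) x) (at x)"
      using \<open>x > 0\<close>
      by (auto intro!: derivative_eq_intros DERIV_chain2[of "poly p"] poly_DERIV
          simp: flat_def poly_monom field_simps power2_eq_square)
    then show ?thesis
      by (rule has_field_derivative_transform_within_open[where S="{0<..}"])
        (use \<open>x > 0\<close> in \<open>auto simp: flat_def\<close>)
  next
    assume "x < 0"
    have "((\<lambda>x. 0) has_real_derivative flat (monom 1 2 * (p - pderiv p)) x) (at x)"
      using \<open>x < 0\<close> by (simp add: flat_def)
    then show ?thesis
      by (rule has_field_derivative_transform_within_open[where S="{..<0}"])
        (use \<open>x < 0\<close> in \<open>auto simp: flat_def\<close>)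
  qed
qed

lemma flat_component_has_derivative:
  fixes x :: "real^'n"
  shows "((\<lambda>x. of_real (flat p (a * x $ i + b)) :: complex) has_derivative
    (\<lambda>v. of_real (flat (monom 1 2 * (p - pderiv p)) (a * x $ i + b)) * of_real (a * v $ i))) (at x)"
    (is "(_ has_derivative (\<lambda>v. of_real ?q * _)) _")
proof -
  have outer: "(flat p has_derivative (\<lambda>v. ?q * v)) (at (a * x $ i + b))"
    using flat_has_real_derivative[of p "a * x $ i + b"] by (simp only: has_field_derivative_def)
  have inner: "((\<lambda>x. a * x $ i + b) has_derivative (\<lambda>v. a * v $ i)) (at x)"
    by (auto intro!: derivative_eq_intros bounded_linear_imp_has_derivative bounded_linear_vec_nth)
  show ?thesis
    using has_derivative_of_real[OF has_derivative_compose[OF inner outer]] by simp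
qed

inductive_set flat_algebra :: "(real^'n::finite \<Rightarrow> complex) set" where
  const: "(\<lambda>x. c) \<in> flat_algebra"
| flat: "(\<lambda>x. of_real (flat p (a * x $ i + b))) \<in> flat_algebra"
| add: "f \<in> flat_algebra \<Longrightarrow> g \<in> flat_algebra \<Longrightarrow> (\<lambda>x. f x + g x) \<in> flat_algebra"
| mult: "f \<in> flat_algebra \<Longrightarrow> g \<in> flat_algebra \<Longrightarrow> (\<lambda>x. f x * g x) \<in> flat_algebra"

lemma flat_algebra_prod:
  "(\<And>i. i \<in> I \<Longrightarrow> f i \<in> flat_algebra) \<Longrightarrow> (\<lambda>x. \<Prod>i\<in>I. f i x) \<in> flat_algebra"
  by (induction I rule: infinite_finite_induct) (auto intro: flat_algebra.const flat_algebra.mult)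

lemma flat_algebra_has_derivative:
  fixes f :: "real^'n \<Rightarrow> complex"
  assumes "f \<in> flat_algebra"
  shows "\<exists>f'. (\<forall>x. (f has_derivative f' x) (at x)) \<and> (\<forall>j. (\<lambda>x. f' x (axis j 1)) \<in> flat_algebra)"
  using assms
proof induction
  case (const c)
  show ?case
    by (rule exI[of _ "\<lambda>x v. 0"]) (auto intro: flat_algebra.const)
next
  case (flat p a i b)
  define q where "q = monom 1 2 * (p - pderiv p)"
  have "((\<lambda>x. of_real (flat p (a * x $ i + b)) :: complex) has_derivative
      (\<lambda>v. of_real (flat q (a * x $ i + b)) * of_real (a * v $ i))) (at x)" for x :: "real^'n"
    unfolding q_def by (rule flat_component_has_derivative)
  moreover have "(\<lambda>x. of_real (flat q (a * x $ i + b)) * of_real (a * (axis j 1 :: real^'n) $ i))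
      \<in> flat_algebra" for j
    by (intro flat_algebra.intros)
  ultimately show ?case
    by (intro exI[of _ "\<lambda>x v. of_real (flat q (a * x $ i + b)) * of_real (a * v $ i)"]) blast
next
  case (add f g)
  then obtain f' g' where
    "\<And>x. (f has_derivative f' x) (at x)" "\<And>j. (\<lambda>x. f' x (axis j 1)) \<in> flat_algebra"
    "\<And>x. (g has_derivative g' x) (at x)" "\<And>j. (\<lambda>x. g' x (axis j 1)) \<in> flat_algebra" by blast
  then show ?case
    by (intro exI[of _ "\<lambda>x v. f' x v + g' x v"])
      (auto intro: flat_algebra.add has_derivative_add)
next
  case (mult f g)
  then obtain f' g' where
    "\<And>x. (f has_derivative f' x) (at x)" "\<And>j. (\<lambda>x. f' x (axis j 1)) \<in> flat_algebra"
    "\<And>x. (g has_derivative g' x) (at x)" "\<And>j. (\<lambda>x. g' x (axis j 1)) \<in> flat_algebra" by blast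
  with mult.hyps show ?case
    by (intro exI[of _ "\<lambda>x v. f x * g' x v + f' x v * g x"] conjI allI has_derivative_mult
        flat_algebra.add flat_algebra.mult)
qed

lemma flat_algebra_C_k: "f \<in> flat_algebra \<Longrightarrow> C_k k f"
proof (induction k arbitrary: f)
  case 0
  then obtain f' where "\<And>x. (f has_derivative f' x) (at x)"
    using flat_algebra_has_derivative by blast
  then show ?case
    by (auto intro!: continuous_at_imp_continuous_on has_derivative_continuous)
next
  case (Suc k)
  then obtain f' where f'_deriv: "\<And>x. (f has_derivative f' x) (at x)"
    "\<And>j. (\<lambda>x. f' x (axis j 1)) \<in> flat_algebra"
    using flat_algebra_has_derivative by blast
  have "partial_deriv j f = (\<lambda>x. f' x (axis j 1))" for j
    using frechet_derivative_at[OF f'_deriv(1)] by (auto simp: partial_deriv_def fun_eq_iff)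
  then show ?case
    using Suc.IH f'_deriv
    by (auto simp: differentiable_on_def differentiable_def intro: has_derivative_at_withinI)
qed

definition box_bump :: "real \<Rightarrow> real^'n \<Rightarrow> real^'n \<Rightarrow> real^'n::finite \<Rightarrow> complex" where
  "box_bump m a b x =
     (\<Prod>i\<in>UNIV. of_real (flat 1 (m * (x $ i - a $ i))) * of_real (flat 1 (m * (b $ i - x $ i))))"

lemma box_bump_outside:
  assumes "m \<ge> 0" "x \<notin> box a b"
  shows "box_bump m a b x = 0"
proof -
  obtain i where "x $ i - a $ i \<le> 0 \<or> b $ i - x $ i \<le> 0"
    using assms(2) by (auto simp: mem_box_cart not_less)
  then have "m * (x $ i - a $ i) \<le> 0 \<or> m * (b $ i - x $ i) \<le> 0"
    using assms(1) mult_nonneg_nonpos by blast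
  then have "flat 1 (m * (x $ i - a $ i)) = 0 \<or> flat 1 (m * (b $ i - x $ i)) = 0"
    by (auto simp: flat_def)
  then show ?thesis
    unfolding box_bump_def by (intro prod_zero) auto
qed

lemma norm_box_bump_le:
  assumes "m \<ge> 0"
  shows "cmod (box_bump m a b x) \<le> indicator (box a b) x"
proof (cases "x \<in> box a b")
  case True
  have "cmod (box_bump m a b x) \<le> 1"
    unfolding box_bump_def prod_norm[symmetric] norm_mult norm_of_real
    by (intro prod_le_1) (auto intro!: mult_le_one simp: flat_1_nonneg flat_1_le_1)
  then show ?thesis using True by simp
qed (simp add: box_bump_outside assms)

lemma test_function_box_bump:
  assumes "m \<ge> 0"
  shows "test_function (box_bump m a b)"
proof -
  have "(\<lambda>x. of_real (flat 1 (m * x $ i + (- m * a $ i))) *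
      of_real (flat 1 (- m * x $ i + m * b $ i))) \<in> flat_algebra" for i
    by (intro flat_algebra.intros)
  then have "box_bump m a b \<in> flat_algebra"
    unfolding box_bump_def by (intro flat_algebra_prod) (simp add: algebra_simps)
  moreover have "{x. box_bump m a b x \<noteq> 0} \<subseteq> box a b"
    using box_bump_outside[OF assms] by blast
  then have "compact (closure {x. box_bump m a b x \<noteq> 0})"
    using bounded_box bounded_subset compact_closure by blast
  ultimately show ?thesis
    unfolding test_function_def using flat_algebra_C_k by blast
qed

lemma flat_1_tendsto_1: "(flat 1 \<longlongrightarrow> 1) at_top"
proof -
  have "((\<lambda>x. exp (- inverse x)) \<longlongrightarrow> exp (- 0)) (at_top :: real filter)"
    by (intro tendsto_intros tendsto_inverse_0_at_top filterlim_ident)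
  then have "((\<lambda>x. exp (- inverse x)) \<longlongrightarrow> (1::real)) at_top" by simp
  then show ?thesis
    by (rule Lim_transform_eventually)
      (auto simp: flat_def inverse_eq_divide intro: eventually_mono[OF eventually_gt_at_top[of 0]])
qed

lemma box_bump_tendsto: "((\<lambda>m. box_bump m a b x) \<longlongrightarrow> indicator (box a b) x) at_top"
proof (cases "x \<in> box a b")
  case True
  have "((\<lambda>m. flat 1 (m * s)) \<longlongrightarrow> 1) at_top" if "s > 0" for s
    using that
    by (intro filterlim_compose[OF flat_1_tendsto_1] filterlim_ident
        filterlim_at_top_mult_tendsto_pos[OF tendsto_const])
  then have "((\<lambda>m. box_bump m a b x) \<longlongrightarrow> (\<Prod>i\<in>(UNIV::'a set). of_real 1 * of_real 1)) at_top"
    unfolding box_bump_def using True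
    by (intro tendsto_prod tendsto_mult tendsto_of_real) (auto simp: mem_box_cart)
  then show ?thesis using True by simp
next
  case False
  show ?thesis
    using False by (intro tendsto_eventually eventually_mono[OF eventually_ge_at_top[of 0]])
      (simp add: box_bump_outside)
qed

section \<open>Test functions and uniqueness of weak derivatives\<close>

lemma test_function_continuous: "test_function \<phi> \<Longrightarrow> continuous_on UNIV \<phi>"
  unfolding test_function_def by (metis C_k.simps(1))

lemma test_function_differentiable: "test_function \<phi> \<Longrightarrow> \<phi> differentiable (at x)"
  unfolding test_function_def by (metis C_k.simps(2) differentiable_on_def UNIV_I)

lemma test_function_borel_measurable: "test_function \<phi> \<Longrightarrow> \<phi> \<in> borel_measurable borel"
  by (intro borel_measurable_continuous_onI test_function_continuous)

lemma test_function_compact: "test_function \<phi> \<Longrightarrow> compact (closure {x. \<phi> x \<noteq> 0})"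
  unfolding test_function_def by blast

lemma test_function_partial_deriv:
  fixes \<phi> :: "real^'n \<Rightarrow> complex"
  assumes "test_function \<phi>"
  shows "test_function (partial_deriv i \<phi>)"
proof -
  let ?S = "closure {x. \<phi> x \<noteq> 0}"
  have "partial_deriv i \<phi> x = 0" if "x \<notin> ?S" for x
  proof -
    have "((\<lambda>_. 0) has_derivative (\<lambda>_. 0)) (at x)" by simp
    then have "(\<phi> has_derivative (\<lambda>_. 0)) (at x)"
      by (rule has_derivative_transform_within_open[where s="- ?S"])
        (use that closure_subset[of "{x. \<phi> x \<noteq> 0}"] in auto)
    then have "frechet_derivative \<phi> (at x) = (\<lambda>_. 0)"
      by (rule frechet_derivative_at[symmetric])
    then show ?thesis by (simp add: partial_deriv_def)
  qed
  then have "{x. partial_deriv i \<phi> x \<noteq> 0} \<subseteq> ?S" by blast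
  then have "compact (closure {x. partial_deriv i \<phi> x \<noteq> 0})"
    unfolding compact_closure
    by (rule bounded_subset[OF compact_imp_bounded[OF test_function_compact[OF assms]]])
  moreover have "C_k k (partial_deriv i \<phi>)" for k
  proof -
    have "C_k (Suc k) \<phi>" using assms unfolding test_function_def by blast
    then show ?thesis by simp
  qed
  ultimately show ?thesis unfolding test_function_def by blast
qed

lemma test_function_bounded:
  assumes "test_function \<phi>"
  obtains K where "\<And>x. cmod (\<phi> x) \<le> K"
proof -
  let ?S = "closure {x. \<phi> x \<noteq> 0}"
  have "compact (\<phi> ` ?S)"
    by (rule compact_continuous_image[OF continuous_on_subset[OF test_function_continuous]])
      (simp_all only: assms subset_UNIV test_function_compact)
  then obtain K where "\<And>x. x \<in> ?S \<Longrightarrow> cmod (\<phi> x) \<le> K"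
    using compact_imp_bounded bounded_iff by (metis imageI)
  then have "cmod (\<phi> x) \<le> max K 0" for x
    using closure_subset[of "{x. \<phi> x \<noteq> 0}"] by (cases "\<phi> x = 0") (auto intro: max.coboundedI1)
  then show ?thesis by (rule that)
qed

lemma
  assumes "test_function \<phi>"
  shows test_function_L2: "\<phi> \<in> L2 lborel" and test_function_integrable: "integrable lborel \<phi>"
proof -
  define S where "S = closure {x. \<phi> x \<noteq> 0}"
  obtain K where \<phi>_le: "\<And>x. cmod (\<phi> x) \<le> K" using test_function_bounded[OF assms] by blast
  have support_sets: "S \<in> sets borel" "emeasure lborel S < \<infinity>"
    unfolding S_def
    by (simp, intro emeasure_bounded_finite compact_imp_bounded test_function_compact assms)
  have outside: "\<phi> x = 0" if "x \<notin> S" for x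
    using that closure_subset[of "{x. \<phi> x \<noteq> 0}"] unfolding S_def by blast
  show "\<phi> \<in> L2 lborel"
    using \<phi>_le support_sets outside test_function_borel_measurable[OF assms]
    by (intro L2_finite_support[of _ _ S K]) auto
  show "integrable lborel \<phi>"
    using \<phi>_le support_sets outside test_function_borel_measurable[OF assms]
    by (intro integrableI_bounded_set[of S _ _ K]) auto
qed

lemma (in sigma_finite_measure) AE_0_if_integrals_0_generator:
  fixes f :: "'a \<Rightarrow> 'b::{banach, second_countable_topology}"
  assumes f_integrable: "integrable M f"
    and generator: "sets M = sigma_sets (space M) G" "Int_stable G"
    and zero: "\<And>A. A \<in> G \<Longrightarrow> (LINT x:A|M. f x) = 0" and total: "(LINT x|M. f x) = 0"
  shows "AE x in M. f x = 0"
proof (rule density_zero[OF f_integrable])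
  have "G \<subseteq> Pow (space M)"
    using generator(1) sets.space_closed[of M] by auto
  fix A assume "A \<in> sets M"
  then have "A \<in> sigma_sets (space M) G" using generator(1) by simp
  with generator(2) \<open>G \<subseteq> Pow (space M)\<close> show "(LINT x:A|M. f x) = 0"
  proof (induction rule: sigma_sets_induct_disjoint)
    case (basic A)
    then show ?case by (rule zero)
  next
    case empty
    then show ?case by (simp add: set_lebesgue_integral_def)
  next
    case (compl A)
    have "(LINT x:(space M - A)|M. f x) = (LINT x|M. f x - indicator A x *\<^sub>R f x)"
      unfolding set_lebesgue_integral_def
      by (rule Bochner_Integration.integral_cong) (auto simp: indicator_def)
    also have "\<dots> = (LINT x|M. f x) - (LINT x:A|M. f x)"
      using compl(1) generator(1) f_integrable unfolding set_lebesgue_integral_def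
      by (intro Bochner_Integration.integral_diff integrable_mult_indicator) auto
    finally show ?case using compl total by simp
  next
    case (union A)
    have "range A \<subseteq> sets M" using union(2) generator(1) by simp
    then have "(LINT x:(\<Union>i. A i)|M. f x) = (\<Sum>i. LINT x:A i|M. f x)"
      using union(1) f_integrable unfolding set_integrable_def disjoint_family_on_def
      by (intro lebesgue_integral_countable_add)
        (auto simp: set_integrable_def intro!: integrable_mult_indicator sets.countable_UN)
    then show ?case using union by simp
  qed
qed

lemma AE_0_if_box_integrals_0:
  fixes f :: "'a::euclidean_space \<Rightarrow> 'b::{banach, second_countable_topology}"
  assumes f_set_integrable: "\<And>a b. set_integrable lborel (box a b) f"
    and zero: "\<And>a b. (LINT x:box a b|lborel. f x) = 0"
  shows "AE x in lborel. f x = 0"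
proof -
  define B where "B R = (box (- (real R *\<^sub>R One)) (real R *\<^sub>R One) :: 'a set)" for R
  have "AE x in lborel. indicator (B R) x *\<^sub>R f x = 0" for R
  proof (rule lborel.AE_0_if_integrals_0_generator[where G="range (\<lambda>(a, b). box a b)"])
    show "integrable lborel (\<lambda>x. indicator (B R) x *\<^sub>R f x)"
      using f_set_integrable by (simp add: set_integrable_def B_def)
    show "sets lborel = sigma_sets (space lborel) (range (\<lambda>(a, b). box a b :: 'a set))"
      by (simp add: borel_eq_box)
    show "Int_stable (range (\<lambda>(a, b). box a b :: 'a set))"
      by (auto simp: Int_stable_def box_Int_box)
    show "(LINT x|lborel. indicator (B R) x *\<^sub>R f x) = 0"
      using zero by (simp add: set_lebesgue_integral_def B_def)
    show "(LINT x:A|lborel. indicator (B R) x *\<^sub>R f x) = 0"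
      if A_box: "A \<in> range (\<lambda>(a, b). box a b)" for A
    proof -
      obtain a b where A_eq: "A = box a b" using A_box by auto
      obtain c d where "A \<inter> B R = box c d" unfolding A_eq B_def box_Int_box by blast
      then have "(LINT x:A|lborel. indicator (B R) x *\<^sub>R f x) = (LINT x:box c d|lborel. f x)"
        by (simp add: set_lebesgue_integral_def flip: indicator_inter_arith)
      then show ?thesis by (simp add: zero)
    qed
  qed
  then have "AE x in lborel. \<forall>R. indicator (B R) x *\<^sub>R f x = 0" unfolding AE_all_countable ..
  then show ?thesis
  proof eventually_elim
    case (elim x)
    have "x \<in> (\<Union>R. B R)" unfolding B_def UN_box_eq_UNIV by simp
    then obtain R where "x \<in> B R" by blast
    then show ?case using elim[rule_format, of R] by simp
  qed
qed

lemma AE_0_if_test_integrals_0: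
  fixes f :: "real^'n \<Rightarrow> complex"
  assumes [measurable]: "f \<in> borel_measurable borel"
    and loc: "\<And>a b. set_integrable lborel (box a b) f"
    and zero: "\<And>\<phi>. test_function \<phi> \<Longrightarrow> (LINT x|lborel. f x * \<phi> x) = 0"
  shows "AE x in lborel. f x = 0"
proof (rule AE_0_if_box_integrals_0[OF loc])
  fix a b :: "real^'n"
  let ?bump = "\<lambda>m. box_bump (real m) a b"
  have [measurable]: "?bump m \<in> borel_measurable borel" for m
    by (intro test_function_borel_measurable test_function_box_bump) simp
  have "(\<lambda>m. LINT x|lborel. f x * ?bump m x) \<longlonglongrightarrow> (LINT x|lborel. f x * indicator (box a b) x)"
  proof (rule integral_dominated_convergence)
    show "integrable lborel (\<lambda>x. cmod (indicator (box a b) x *\<^sub>R f x))"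
      using loc by (intro integrable_norm) (simp add: set_integrable_def)
    show "AE x in lborel. (\<lambda>m. f x * ?bump m x) \<longlonglongrightarrow> f x * indicator (box a b) x"
      by (intro AE_I2 tendsto_mult tendsto_const
          filterlim_compose[OF box_bump_tendsto filterlim_real_sequentially])
    show "AE x in lborel. norm (f x * ?bump m x) \<le> cmod (indicator (box a b) x *\<^sub>R f x)" for m
      using norm_box_bump_le[of "real m" a b]
      by (intro AE_I2) (simp add: norm_mult mult.commute mult_left_mono)
  qed measurable
  moreover have "(LINT x|lborel. f x * ?bump m x) = 0" for m
    by (intro zero test_function_box_bump) simp
  ultimately have "(LINT x|lborel. f x * indicator (box a b) x) = 0"
    by (simp add: LIMSEQ_const_iff)
  then show "(LINT x:box a b|lborel. f x) = 0"
    by (simp add: set_lebesgue_integral_def scaleR_conv_of_real mult.commute of_real_indicator)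
qed

lemma L2_set_integrable:
  assumes f_L2: "f \<in> L2 M" and A_finite: "A \<in> sets M" "emeasure M A < \<infinity>"
  shows "set_integrable M A f"
proof -
  have "(indicator A :: _ \<Rightarrow> complex) \<in> L2 M"
    using A_finite by (intro L2_finite_support[of _ _ A 1]) (auto simp: indicator_def)
  from L2_integrable_mult_cnj[OF f_L2 this]
  have "integrable M (\<lambda>x. f x * cnj (indicator A x))" .
  also have "(\<lambda>x. f x * cnj (indicator A x)) = (\<lambda>x. indicator A x *\<^sub>R f x)"
    by (auto simp: indicator_def)
  finally show ?thesis by (simp add: set_integrable_def)
qed

lemma L2_norm_weak_deriv:
  fixes f g :: "real^'n \<Rightarrow> complex"
  assumes g_weak_deriv: "g \<in> L2 lborel" "is_weak_deriv i f g"
  shows "L2_norm lborel (weak_deriv i f) = L2_norm lborel g"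
proof -
  define w where "w = weak_deriv i f"
  have "w \<in> L2 lborel \<and> is_weak_deriv i f w"
    unfolding w_def weak_deriv_def by (rule someI[of _ g]) (use g_weak_deriv in auto)
  then have w_weak_deriv: "w \<in> L2 lborel" "is_weak_deriv i f w" by auto
  have w_minus_g_L2: "(\<lambda>x. w x - g x) \<in> L2 lborel" by (intro L2_diff w_weak_deriv g_weak_deriv)
  have "AE x in lborel. w x - g x = 0"
  proof (rule AE_0_if_test_integrals_0)
    show "(\<lambda>x. w x - g x) \<in> borel_measurable borel" using L2_measurable[OF w_minus_g_L2] by simp
    show "set_integrable lborel (box a b) (\<lambda>x. w x - g x)" for a b
      by (rule L2_set_integrable[OF w_minus_g_L2]) (auto simp: emeasure_lborel_box_eq)
    fix \<phi> :: "real^'n \<Rightarrow> complex" assume test_\<phi>: "test_function \<phi>"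
    have integrable: "integrable lborel (\<lambda>x. u x * \<phi> x)" if "u \<in> L2 lborel" for u
      using L2_integrable_mult_cnj[OF that L2_cnj[OF test_function_L2[OF test_\<phi>]]] by simp
    have "(LINT x|lborel. w x * \<phi> x) = (LINT x|lborel. g x * \<phi> x)"
      using w_weak_deriv(2) g_weak_deriv(2) test_\<phi> unfolding is_weak_deriv_def
      by (metis neg_equal_iff_equal)
    then show "(LINT x|lborel. (w x - g x) * \<phi> x) = 0"
      by (simp add: left_diff_distrib integrable w_weak_deriv g_weak_deriv)
  qed
  then show ?thesis unfolding w_def[symmetric]
    by (intro L2_norm_cong_AE L2_measurable w_weak_deriv g_weak_deriv) auto
qed

section \<open>Integration by parts along a direction\<close>

definition dominated_derivative ::
    "'a::euclidean_space \<Rightarrow> ('a \<Rightarrow> complex) \<Rightarrow> ('a \<Rightarrow> complex) \<Rightarrow> ('a \<Rightarrow> real) \<Rightarrow> bool" where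
  "dominated_derivative e u u' U \<longleftrightarrow>
     u \<in> borel_measurable borel \<and> u' \<in> borel_measurable borel \<and> U \<in> borel_measurable borel \<and>
     (\<forall>x s. \<bar>s\<bar> \<le> 1 \<longrightarrow> cmod (u (x + s *\<^sub>R e) - u x) \<le> \<bar>s\<bar> * U x) \<and>
     (AE x in lborel. ((\<lambda>s. u (x + s *\<^sub>R e)) has_vector_derivative u' x) (at 0))"

lemma dominated_derivative_measurable:
  assumes "dominated_derivative e u u' U"
  shows "u \<in> borel_measurable borel" "u' \<in> borel_measurable borel" "U \<in> borel_measurable borel"
  using assms by (auto simp: dominated_derivative_def)

lemma dominated_derivativeD:
  assumes "dominated_derivative e u u' U"
  shows "\<bar>s\<bar> \<le> 1 \<Longrightarrow> cmod (u (x + s *\<^sub>R e) - u x) \<le> \<bar>s\<bar> * U x"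
    and "AE x in lborel. ((\<lambda>s. u (x + s *\<^sub>R e)) has_vector_derivative u' x) (at 0)"
  using assms by (auto simp: dominated_derivative_def)

lemma has_vector_derivative_imp_tendsto:
  assumes "(f has_vector_derivative v) (at t)"
  shows "((\<lambda>s. (f (t + s) - f t) /\<^sub>R s) \<longlongrightarrow> v) (at 0)"
proof -
  have "((\<lambda>s. norm (f (t + s) - f t - s *\<^sub>R v) / norm s) \<longlongrightarrow> 0) (at 0)"
    using assms by (simp add: has_vector_derivative_def has_derivative_at)
  moreover have "\<forall>\<^sub>F s in at 0.
      norm (f (t + s) - f t - s *\<^sub>R v) / norm s = norm ((f (t + s) - f t) /\<^sub>R s - v)"
    unfolding eventually_at_filter
  proof (intro always_eventually allI impI)
    fix s :: real assume "s \<noteq> 0"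
    then have "(f (t + s) - f t) /\<^sub>R s - v = (f (t + s) - f t - s *\<^sub>R v) /\<^sub>R s"
      by (simp add: scaleR_diff_right)
    then show "norm (f (t + s) - f t - s *\<^sub>R v) / norm s = norm ((f (t + s) - f t) /\<^sub>R s - v)"
      by (simp add: divide_inverse mult.commute)
  qed
  ultimately have "((\<lambda>s. norm ((f (t + s) - f t) /\<^sub>R s - v)) \<longlongrightarrow> 0) (at 0)"
    by (rule Lim_transform_eventually)
  then show ?thesis
    by (rule LIM_zero_cancel[OF tendsto_norm_zero_cancel])
qed

lemma norm_difference_mult_le:
  assumes "dominated_derivative e u u' U" and "\<bar>s\<bar> \<le> 1"
  shows "cmod ((u (x + s *\<^sub>R e) - u x) * z) \<le> \<bar>s\<bar> * (U x * cmod z)"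
  using mult_right_mono[OF dominated_derivativeD(1)[OF assms] norm_ge_zero]
  by (simp add: norm_mult mult.assoc)

lemma integrable_difference_mult:
  assumes u_deriv: "dominated_derivative e u u' U"
    and [measurable]: "w \<in> borel_measurable borel"
    and U_w_integrable: "integrable lborel (\<lambda>x. U x * cmod (w x))" and s_le: "\<bar>s\<bar> \<le> 1"
  shows "integrable lborel (\<lambda>x. (u (x + s *\<^sub>R e) - u x) * w x)"
proof (rule Bochner_Integration.integrable_bound)
  note [measurable] = dominated_derivative_measurable[OF u_deriv]
  show "integrable lborel (\<lambda>x. \<bar>s\<bar> * (U x * cmod (w x)))" using U_w_integrable by simp
  show "AE x in lborel. norm ((u (x + s *\<^sub>R e) - u x) * w x) \<le> norm (\<bar>s\<bar> * (U x * cmod (w x)))"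
    using order_trans[OF norm_difference_mult_le[OF u_deriv s_le] abs_ge_self] by (intro AE_I2) simp
  show "(\<lambda>x. (u (x + s *\<^sub>R e) - u x) * w x) \<in> borel_measurable lborel" by measurable
qed

lemma integral_difference_quotient_tendsto:
  assumes u_deriv: "dominated_derivative e u u' U"
    and [measurable]: "w \<in> borel_measurable borel"
    and U_w_integrable: "integrable lborel (\<lambda>x. U x * cmod (w x))"
    and null_sequence: "\<epsilon> \<longlonglongrightarrow> 0" "\<And>m. \<epsilon> m \<noteq> 0" "\<And>m. \<bar>\<epsilon> m\<bar> \<le> 1"
  shows "(\<lambda>m. LINT x|lborel. ((u (x + \<epsilon> m *\<^sub>R e) - u x) /\<^sub>R \<epsilon> m) * w x) \<longlonglongrightarrow>
    (LINT x|lborel. u' x * w x)"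
proof (rule integral_dominated_convergence[OF _ _ U_w_integrable])
  note [measurable] = dominated_derivative_measurable[OF u_deriv]
  show "(\<lambda>x. u' x * w x) \<in> borel_measurable lborel" by measurable
  show "(\<lambda>x. ((u (x + \<epsilon> m *\<^sub>R e) - u x) /\<^sub>R \<epsilon> m) * w x) \<in> borel_measurable lborel" for m by measurable
  have \<epsilon>_at_0: "filterlim \<epsilon> (at 0) sequentially"
    using null_sequence(1,2) by (simp add: filterlim_at)
  show "AE x in lborel. (\<lambda>m. ((u (x + \<epsilon> m *\<^sub>R e) - u x) /\<^sub>R \<epsilon> m) * w x) \<longlonglongrightarrow> u' x * w x"
    using dominated_derivativeD(2)[OF u_deriv]
  proof eventually_elim
    case (elim x)
    from filterlim_compose[OF has_vector_derivative_imp_tendsto[OF elim] \<epsilon>_at_0]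
    show ?case by (intro tendsto_mult tendsto_const) simp
  qed
  show "AE x in lborel. norm (((u (x + \<epsilon> m *\<^sub>R e) - u x) /\<^sub>R \<epsilon> m) * w x) \<le> U x * cmod (w x)" for m
  proof (intro AE_I2)
    fix x
    have "norm (((u (x + \<epsilon> m *\<^sub>R e) - u x) /\<^sub>R \<epsilon> m) * w x) =
        cmod ((u (x + \<epsilon> m *\<^sub>R e) - u x) * w x) / \<bar>\<epsilon> m\<bar>"
      by (simp add: norm_mult divide_inverse)
    also have "\<dots> \<le> U x * cmod (w x)"
      using norm_difference_mult_le[OF u_deriv null_sequence(3)[of m], of x "w x"]
        null_sequence(2)[of m]
      by (simp add: pos_divide_le_eq mult.commute)
    finally show "norm (((u (x + \<epsilon> m *\<^sub>R e) - u x) /\<^sub>R \<epsilon> m) * w x) \<le> U x * cmod (w x)" .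
  qed
qed

lemma integral_lborel_translate:
  fixes f :: "'a::euclidean_space \<Rightarrow> 'b::{banach, second_countable_topology}"
  assumes [measurable]: "f \<in> borel_measurable borel"
  shows "(LINT x|lborel. f (x + a)) = (LINT x|lborel. f x)"
proof -
  have "(LINT x|lborel. f x) = (LINT x|distr lborel borel ((+) a). f x)"
    by (simp add: lborel_distr_plus)
  then show ?thesis by (simp add: integral_distr add.commute)
qed

context
  fixes e :: "'a::euclidean_space" and u u' v v' :: "'a \<Rightarrow> complex" and U V :: "'a \<Rightarrow> real"
  assumes u_deriv: "dominated_derivative e u u' U" and v_deriv: "dominated_derivative e v v' V"
    and U_v_integrable: "integrable lborel (\<lambda>x. U x * cmod (v x))"
    and V_u_integrable: "integrable lborel (\<lambda>x. V x * cmod (u x))"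
    and u_v_integrable: "integrable lborel (\<lambda>x. u x * v x)"
begin

lemma integral_by_parts_difference:
  assumes s_le: "\<bar>s\<bar> \<le> 1"
  shows "(LINT x|lborel. (v (x + s *\<^sub>R e) - v x) * u x) =
      (LINT x|lborel. (u (x - s *\<^sub>R e) - u x) * v x)"
proof -
  note [measurable] = dominated_derivative_measurable[OF u_deriv]
    dominated_derivative_measurable[OF v_deriv]
  let ?F = "\<lambda>x. u (x - s *\<^sub>R e) * v x"
  have "integrable lborel (\<lambda>x. (v (x + s *\<^sub>R e) - v x) * u x + u x * v x)"
    using s_le
    by (intro Bochner_Integration.integrable_add
        integrable_difference_mult[OF v_deriv _ V_u_integrable] u_v_integrable) auto
  then have "(LINT x|lborel. (v (x + s *\<^sub>R e) - v x) * u x) =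
      (LINT x|lborel. ?F (x + s *\<^sub>R e)) - (LINT x|lborel. u x * v x)"
    using u_v_integrable
    by (subst Bochner_Integration.integral_diff[symmetric]) (simp_all add: algebra_simps)
  moreover have "integrable lborel (\<lambda>x. (u (x + (- s) *\<^sub>R e) - u x) * v x + u x * v x)"
    using s_le
    by (intro Bochner_Integration.integrable_add
        integrable_difference_mult[OF u_deriv _ U_v_integrable] u_v_integrable) auto
  then have "(LINT x|lborel. (u (x - s *\<^sub>R e) - u x) * v x) =
      (LINT x|lborel. ?F x) - (LINT x|lborel. u x * v x)"
    using u_v_integrable
    by (subst Bochner_Integration.integral_diff[symmetric]) (simp_all add: algebra_simps)
  moreover have "(LINT x|lborel. ?F (x + s *\<^sub>R e)) = (LINT x|lborel. ?F x)"
    by (rule integral_lborel_translate) measurable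
  ultimately show ?thesis by simp
qed

lemma integral_by_parts_direction:
  "(LINT x|lborel. u x * v' x) = - (LINT x|lborel. u' x * v x)"
proof -
  note [measurable] = dominated_derivative_measurable[OF u_deriv]
    dominated_derivative_measurable[OF v_deriv]
  define \<epsilon> where "\<epsilon> m = inverse (real (Suc m))" for m
  have null_sequence: "\<epsilon> \<longlonglongrightarrow> 0" "\<epsilon> m \<noteq> 0" "\<bar>\<epsilon> m\<bar> \<le> 1" for m
    unfolding \<epsilon>_def using LIMSEQ_inverse_real_of_nat by (auto simp: inverse_le_1_iff)
  have v_quotient: "(\<lambda>m. LINT x|lborel. ((v (x + \<epsilon> m *\<^sub>R e) - v x) /\<^sub>R \<epsilon> m) * u x) \<longlonglongrightarrow>
      (LINT x|lborel. v' x * u x)"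
    by (rule integral_difference_quotient_tendsto[OF v_deriv _ V_u_integrable null_sequence])
      measurable
  have u_quotient: "(\<lambda>m. LINT x|lborel. ((u (x + - \<epsilon> m *\<^sub>R e) - u x) /\<^sub>R - \<epsilon> m) * v x) \<longlonglongrightarrow>
      (LINT x|lborel. u' x * v x)"
    using null_sequence tendsto_minus[OF null_sequence(1)]
    by (intro integral_difference_quotient_tendsto[OF u_deriv _ U_v_integrable]) auto
  have quotients_eq: "(LINT x|lborel. ((v (x + \<epsilon> m *\<^sub>R e) - v x) /\<^sub>R \<epsilon> m) * u x) =
      - (LINT x|lborel. ((u (x + - \<epsilon> m *\<^sub>R e) - u x) /\<^sub>R - \<epsilon> m) * v x)" for m
    using integral_by_parts_difference[OF null_sequence(3)[of m]] by simp
  have "(LINT x|lborel. v' x * u x) = - (LINT x|lborel. u' x * v x)"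
    using v_quotient tendsto_minus[OF u_quotient] unfolding quotients_eq by (rule LIMSEQ_unique)
  then show ?thesis by (simp add: mult.commute)
qed

end

lemma test_function_dominated_derivative:
  fixes \<phi> :: "real^'n \<Rightarrow> complex"
  assumes "test_function \<phi>"
  obtains K where "dominated_derivative (axis i 1) \<phi> (partial_deriv i \<phi>) (\<lambda>_. K)"
proof -
  let ?e = "axis i 1 :: real^'n"
  obtain K where deriv_le: "\<And>x. cmod (partial_deriv i \<phi> x) \<le> K"
    using test_function_bounded[OF test_function_partial_deriv[OF assms]] by blast
  have deriv: "((\<lambda>s. \<phi> (x + s *\<^sub>R ?e)) has_vector_derivative partial_deriv i \<phi> (x + s *\<^sub>R ?e)) (at s)"
    for x s
  proof -
    let ?D = "frechet_derivative \<phi> (at (x + s *\<^sub>R ?e))"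
    have has_derivative: "(\<phi> has_derivative ?D) (at (x + s *\<^sub>R ?e))"
      using test_function_differentiable[OF assms] by (simp add: frechet_derivative_works)
    have "((\<lambda>s. x + s *\<^sub>R ?e) has_derivative (\<lambda>h. h *\<^sub>R ?e)) (at s)"
      by (auto intro!: derivative_eq_intros)
    from has_derivative_compose[OF this has_derivative] show ?thesis
      by (simp add: has_vector_derivative_def partial_deriv_def
          linear_cmul[OF has_derivative_linear[OF has_derivative]])
  qed
  have "cmod (\<phi> (x + s *\<^sub>R ?e) - \<phi> (x + 0 *\<^sub>R ?e)) \<le> K * norm (s - 0)" for x s
    using deriv deriv_le
    by (intro differentiable_bound[where S=UNIV
          and f'="\<lambda>s h. h *\<^sub>R partial_deriv i \<phi> (x + s *\<^sub>R ?e)"])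
      (auto simp: has_vector_derivative_def mult.commute[of K] intro!: onorm_le mult_left_mono)
  then have "dominated_derivative ?e \<phi> (partial_deriv i \<phi>) (\<lambda>_. K)"
    using deriv[of _ 0] test_function_borel_measurable[OF assms]
      test_function_borel_measurable[OF test_function_partial_deriv[OF assms]]
    by (auto simp: dominated_derivative_def mult.commute)
  then show ?thesis by (rule that)
qed

lemma is_weak_deriv_if_dominated:
  fixes f g :: "real^'n \<Rightarrow> complex"
  assumes f_deriv: "dominated_derivative (axis i 1) f g (\<lambda>_. L)" "integrable lborel f"
  shows "is_weak_deriv i f g"
  unfolding is_weak_deriv_def
proof (intro allI impI)
  fix \<phi> :: "real^'n \<Rightarrow> complex" assume test_\<phi>: "test_function \<phi>"
  obtain K where \<phi>_deriv: "dominated_derivative (axis i 1) \<phi> (partial_deriv i \<phi>) (\<lambda>_. K)"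
    using test_function_dominated_derivative[OF test_\<phi>] by blast
  obtain B where \<phi>_le: "\<And>x. cmod (\<phi> x) \<le> B" using test_function_bounded[OF test_\<phi>] by blast
  have "integrable lborel (\<lambda>x. f x * \<phi> x)"
  proof (rule Bochner_Integration.integrable_bound)
    show "integrable lborel (\<lambda>x. f x * of_real B)" using f_deriv(2) by simp
    show "(\<lambda>x. f x * \<phi> x) \<in> borel_measurable lborel"
      using f_deriv(2) test_function_borel_measurable[OF test_\<phi>] by simp
    show "AE x in lborel. norm (f x * \<phi> x) \<le> norm (f x * of_real B)"
      by (auto simp: norm_mult intro!: AE_I2 mult_left_mono order_trans[OF \<phi>_le])
  qed
  then show "(LINT x|lborel. f x * partial_deriv i \<phi> x) = - (LINT x|lborel. g x * \<phi> x)"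
    using f_deriv \<phi>_deriv test_function_integrable[OF test_\<phi>]
    by (intro integral_by_parts_direction) auto
qed

lemma H1_if_dominated:
  fixes f :: "real^'n \<Rightarrow> complex"
  assumes "f \<in> L2 lborel" and "\<And>i. f' i \<in> L2 lborel"
    and f_deriv: "\<And>i. dominated_derivative (axis i 1) f (f' i) (\<lambda>_. L i)" "integrable lborel f"
  shows "f \<in> H1"
    and "H1_norm f = sqrt ((L2_norm lborel f)\<^sup>2 + (\<Sum>i\<in>UNIV. (L2_norm lborel (f' i))\<^sup>2))"
proof -
  note weak_deriv = is_weak_deriv_if_dominated[OF f_deriv]
  then show "f \<in> H1"
    using assms(1,2) unfolding H1_def by blast
  show "H1_norm f = sqrt ((L2_norm lborel f)\<^sup>2 + (\<Sum>i\<in>UNIV. (L2_norm lborel (f' i))\<^sup>2))"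
    unfolding H1_norm_def L2_norm_weak_deriv[OF assms(2) weak_deriv] ..
qed

lemma weak_deriv_works:
  assumes "f \<in> H1"
  shows "weak_deriv i f \<in> L2 lborel" "is_weak_deriv i f (weak_deriv i f)"
proof -
  have "\<exists>g. g \<in> L2 lborel \<and> is_weak_deriv i f g"
    using assms by (auto simp: H1_def)
  from someI_ex[OF this] show "weak_deriv i f \<in> L2 lborel" "is_weak_deriv i f (weak_deriv i f)"
    by (simp_all add: weak_deriv_def)
qed

lemma is_weak_deriv_cmult: "is_weak_deriv i f g \<Longrightarrow> is_weak_deriv i (\<lambda>x. c * f x) (\<lambda>x. c * g x)"
  by (simp add: is_weak_deriv_def mult.assoc)

lemma H1_cmult:
  assumes "f \<in> H1"
  shows "(\<lambda>x. c * f x) \<in> H1"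
  using assms L2_cmult is_weak_deriv_cmult unfolding H1_def by blast

lemma H1_norm_cmult:
  assumes "f \<in> H1"
  shows "H1_norm (\<lambda>x. c * f x) = cmod c * H1_norm f"
proof -
  have "L2_norm lborel (weak_deriv i (\<lambda>x. c * f x)) = cmod c * L2_norm lborel (weak_deriv i f)"
    for i
    using L2_norm_weak_deriv[OF L2_cmult is_weak_deriv_cmult, OF weak_deriv_works[OF assms]]
    by (simp add: L2_norm_cmult)
  then show ?thesis
    by (simp add: H1_norm_def L2_norm_cmult power_mult_distrib real_sqrt_mult
        flip: sum_distrib_left distrib_left)
qed

lemma H1_ball_if_zero_outside:
  assumes "h \<in> H1" and "\<And>x. x \<notin> ball 0 1 \<Longrightarrow> h x = 0"
  shows "h \<in> H1_ball"
proof -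
  have "- cball 0 1 \<subseteq> \<Union>{U. open U \<and> (AE x in lborel. x \<in> U \<longrightarrow> h x = 0)}"
    by (rule Union_upper) (use assms(2) in auto)
  then show ?thesis
    using assms(1) unfolding H1_ball_def ess_support_def by blast
qed

section \<open>Fourier transforms of translates and derivatives\<close>

lemma norm_cis_minus_1_le: "cmod (cis t - 1) \<le> \<bar>t\<bar>"
proof -
  have "cis t - 1 = cis (t / 2) * (cis (t / 2) - cis (- (t / 2)))"
    by (simp add: cis_mult right_diff_distrib)
  also have "cis (t / 2) - cis (- (t / 2)) = 2 * \<i> * of_real (sin (t / 2))"
    by (simp add: complex_eq_iff)
  finally have "cmod (cis t - 1) = 2 * \<bar>sin (t / 2)\<bar>"
    by (simp add: norm_mult)
  then show ?thesis using abs_sin_x_le_abs_x[of "t / 2"] by simp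
qed

lemma fourier_translate:
  assumes [measurable]: "f \<in> borel_measurable borel"
  shows "fourier (\<lambda>x. f (x - a)) \<xi> = cis (\<xi> \<bullet> a) * fourier f \<xi>"
proof -
  have "fourier (\<lambda>x. f (x - a)) \<xi> = (LINT x|lborel. f (x + a - a) * cis (\<xi> \<bullet> (x + a)))"
    unfolding fourier_def by (rule integral_lborel_translate[symmetric]) measurable
  also have "\<dots> = (LINT x|lborel. cis (\<xi> \<bullet> a) * (f x * cis (\<xi> \<bullet> x)))"
    by (simp add: inner_add_right mult_ac flip: cis_mult)
  finally show ?thesis by (simp add: fourier_def)
qed

lemma fourier_sum:
  assumes "\<And>j. j \<in> J \<Longrightarrow> integrable lborel (f j)"
  shows "fourier (\<lambda>x. \<Sum>j\<in>J. f j x) \<xi> = (\<Sum>j\<in>J. fourier (f j) \<xi>)"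
  unfolding fourier_def sum_distrib_right
  by (intro Bochner_Integration.integral_sum integrable_mult_cis assms) measurable

lemma dominated_derivative_cis:
  "dominated_derivative e (\<lambda>x. cis (\<xi> \<bullet> x)) (\<lambda>x. \<i> * of_real (\<xi> \<bullet> e) * cis (\<xi> \<bullet> x)) (\<lambda>_. \<bar>\<xi> \<bullet> e\<bar>)"
proof -
  have "cmod (cis (\<xi> \<bullet> (x + s *\<^sub>R e)) - cis (\<xi> \<bullet> x)) \<le> \<bar>s\<bar> * \<bar>\<xi> \<bullet> e\<bar>" for x s
  proof -
    have "cis (\<xi> \<bullet> (x + s *\<^sub>R e)) - cis (\<xi> \<bullet> x) = cis (\<xi> \<bullet> x) * (cis (s * (\<xi> \<bullet> e)) - 1)"
      by (simp add: inner_add_right right_diff_distrib cis_mult)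
    then show ?thesis
      using norm_cis_minus_1_le[of "s * (\<xi> \<bullet> e)"] by (simp add: norm_mult abs_mult)
  qed
  moreover have "((\<lambda>s. cis (\<xi> \<bullet> (x + s *\<^sub>R e))) has_vector_derivative
      \<i> * of_real (\<xi> \<bullet> e) * cis (\<xi> \<bullet> x)) (at 0)" for x
    unfolding inner_add_right inner_scaleR_right has_vector_derivative_complex_iff
    by (auto intro!: derivative_eq_intros)
  ultimately show ?thesis by (auto simp: dominated_derivative_def)
qed

lemma fourier_dominated_derivative:
  assumes u_deriv: "dominated_derivative e u u' U" and U_integrable: "integrable lborel U"
    and "integrable lborel u"
  shows "fourier u' \<xi> = - (\<i> * of_real (\<xi> \<bullet> e)) * fourier u \<xi>"
proof -
  have "(LINT x|lborel. u x * (\<i> * of_real (\<xi> \<bullet> e) * cis (\<xi> \<bullet> x))) = - fourier u' \<xi>"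
    unfolding fourier_def using assms
    by (intro integral_by_parts_direction[OF u_deriv dominated_derivative_cis])
      (simp_all add: integrable_mult_cis)
  moreover have "(LINT x|lborel. u x * (\<i> * of_real (\<xi> \<bullet> e) * cis (\<xi> \<bullet> x))) =
      \<i> * of_real (\<xi> \<bullet> e) * fourier u \<xi>"
    by (simp add: fourier_def mult.left_commute flip: integral_mult_right_zero)
  ultimately show ?thesis by simp
qed

section \<open>Tensor products\<close>

definition tensor :: "('n::finite \<Rightarrow> real \<Rightarrow> 'a) \<Rightarrow> real^'n \<Rightarrow> 'a::comm_monoid_mult" where
  "tensor f x = (\<Prod>i\<in>UNIV. f i (x $ i))"

lemma tensor_fun_upd: "tensor (f(i := g)) x = g (x $ i) * (\<Prod>j\<in>UNIV - {i}. f j (x $ j))"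
  unfolding tensor_def by (subst prod.remove[of UNIV i]) (auto intro!: prod.cong)

lemma borel_measurable_tensor [measurable]:
  fixes f :: "'n::finite \<Rightarrow> real \<Rightarrow> complex"
  assumes [measurable]: "\<And>i. f i \<in> borel_measurable borel"
  shows "tensor f \<in> borel_measurable borel"
  unfolding tensor_def by measurable

lemma
  fixes f :: "'n::finite \<Rightarrow> real \<Rightarrow> 'a::{real_normed_field, banach, second_countable_topology}"
  assumes f_integrable: "\<And>i. integrable lborel (f i)"
  shows integrable_tensor: "integrable lborel (tensor f)"
    and integral_tensor: "(LINT x|lborel. tensor f x) = (\<Prod>i\<in>UNIV. LINT t|lborel. f i t)"
proof -
  interpret product_sigma_finite "\<lambda>b::real^'n. lborel :: real measure" ..
  let ?F = "\<lambda>b::real^'n. f (axis_index b)"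
  define T where "T u = (\<Sum>b\<in>Basis. u b *\<^sub>R b :: real^'n)" for u
  have [measurable]: "f i \<in> borel_measurable borel" for i
    using f_integrable[of i] by auto
  have [measurable]: "T \<in> (\<Pi>\<^sub>M b\<in>Basis. lborel) \<rightarrow>\<^sub>M borel"
    unfolding T_def by measurable
  have tensor [measurable]: "tensor f \<in> borel_measurable borel"
    unfolding tensor_def by measurable
  have lborel: "(lborel :: (real^'n) measure) = distr (\<Pi>\<^sub>M b\<in>Basis. lborel) borel T"
    unfolding T_def by (rule lborel_eq)
  have "T u \<bullet> axis i 1 = u (axis i 1)" for u i
    unfolding T_def by (rule inner_sum_left_Basis) (simp add: axis_in_Basis_iff)
  then have tensor_T: "tensor f (T u) = (\<Prod>b\<in>Basis. ?F b (u b))" for u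
    unfolding tensor_def prod_Basis_cart by (simp add: inner_axis)
  show "integrable lborel (tensor f)"
    unfolding lborel using f_integrable
    by (subst integrable_distr_eq) (simp_all add: tensor_T, intro product_integrable_prod, simp_all)
  have "(LINT x|lborel. tensor f x) = (\<Prod>b\<in>Basis. LINT t|lborel. ?F b t)"
    unfolding lborel using f_integrable
    by (subst integral_distr) (simp_all add: tensor_T, intro product_integral_prod, simp_all)
  then show "(LINT x|lborel. tensor f x) = (\<Prod>i\<in>UNIV. LINT t|lborel. f i t)"
    by (simp add: prod_Basis_cart)
qed

lemma
  fixes f :: "'n::finite \<Rightarrow> real \<Rightarrow> complex"
  assumes "\<And>i. f i \<in> L2 lborel"
  shows tensor_L2: "tensor f \<in> L2 lborel"
    and L2_norm_tensor: "L2_norm lborel (tensor f) = (\<Prod>i\<in>UNIV. L2_norm lborel (f i))"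
proof -
  have square: "(cmod (tensor f x))\<^sup>2 = tensor (\<lambda>i t. (cmod (f i t))\<^sup>2) x" for x
    by (simp add: tensor_def prod_norm[symmetric] prod_power_distrib)
  have f_square_integrable: "f i \<in> borel_measurable borel" "integrable lborel (\<lambda>t. (cmod (f i t))\<^sup>2)"
    for i
    using assms[of i] by (auto simp: L2_def)
  show "tensor f \<in> L2 lborel"
    using f_square_integrable by (simp add: L2_def square integrable_tensor)
  have "(L2_norm lborel (tensor f))\<^sup>2 = (\<Prod>i\<in>UNIV. L2_norm lborel (f i))\<^sup>2"
    by (simp add: L2_norm_square square integral_tensor f_square_integrable(2) prod_power_distrib)
  then show "L2_norm lborel (tensor f) = (\<Prod>i\<in>UNIV. L2_norm lborel (f i))"
    by (simp add: prod_nonneg)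
qed

lemma L2_norm_tensor_fun_upd:
  fixes f :: "'n::finite \<Rightarrow> real \<Rightarrow> complex"
  assumes "\<And>j. f j \<in> L2 lborel" "g \<in> L2 lborel"
  shows "L2_norm lborel (tensor (f(i := g))) =
      L2_norm lborel g * (\<Prod>j\<in>UNIV - {i}. L2_norm lborel (f j))"
proof -
  have "L2_norm lborel (tensor (f(i := g))) = (\<Prod>j\<in>UNIV. L2_norm lborel ((f(i := g)) j))"
    using assms by (intro L2_norm_tensor) simp
  also have "\<dots> = L2_norm lborel g * (\<Prod>j\<in>UNIV - {i}. L2_norm lborel (f j))"
    by (subst prod.remove[of UNIV i]) (auto intro!: prod.cong)
  finally show ?thesis .
qed

lemma fourier_tensor:
  fixes f :: "'n::finite \<Rightarrow> real \<Rightarrow> complex"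
  assumes f_integrable: "\<And>i. integrable lborel (f i)"
  shows "fourier (tensor f) \<xi> = (\<Prod>i\<in>UNIV. fourier (f i) (\<xi> $ i))"
proof -
  have "cis (\<xi> \<bullet> x) = (\<Prod>i\<in>UNIV. cis (\<xi> $ i * x $ i))" for x
    by (simp add: inner_vec_def cis_conv_exp sum_distrib_left exp_sum)
  then have "fourier (tensor f) \<xi> = (LINT x|lborel. tensor (\<lambda>i t. f i t * cis (\<xi> $ i * t)) x)"
    by (simp add: fourier_def tensor_def prod.distrib)
  also have "\<dots> = (\<Prod>i\<in>UNIV. fourier (f i) (\<xi> $ i))"
    using f_integrable by (simp add: integral_tensor integrable_mult_cis fourier_def)
  finally show ?thesis .
qed

lemma AE_lborel_component:
  fixes i :: "'n::finite"
  assumes "AE t in lborel. P t"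
  shows "AE x in lborel. P ((x :: real^'n) $ i)"
proof -
  obtain N where "{t \<in> space lborel. \<not> P t} \<subseteq> N"
    and null_N: "emeasure lborel N = 0" "N \<in> sets lborel"
    using assms by (rule AE_E)
  then have P_off_N: "P t" if "t \<notin> N" for t using that by auto
  have "(\<integral>\<^sup>+x. indicator N ((x :: real^'n) $ i) \<partial>lborel) =
      (\<integral>\<^sup>+x. (\<Prod>j\<in>UNIV. (if j = i then indicator N else (\<lambda>_. 1)) ((x :: real^'n) $ j)) \<partial>lborel)"
    by (intro nn_integral_cong) (simp add: if_distrib[of "\<lambda>g. g _"] cong: if_cong)
  also have "\<dots> = (\<Prod>j\<in>UNIV. \<integral>\<^sup>+t. (if j = i then indicator N else (\<lambda>_. 1)) t \<partial>lborel)"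
    using null_N(2) by (intro nn_integral_lborel_cart_prod) simp
  also have "\<dots> = 0"
    using null_N by (intro prod_zero) (auto intro!: bexI[of _ i])
  finally have "AE x in lborel. indicator N ((x :: real^'n) $ i) = (0 :: ennreal)"
    using null_N(2) by (subst (asm) nn_integral_0_iff_AE) simp_all
  then show ?thesis
    by eventually_elim (auto intro!: P_off_N simp: indicator_def split: if_splits)
qed

lemma tensor_nonzero_imp_norm_le:
  fixes f :: "'n::finite \<Rightarrow> real \<Rightarrow> 'a::idom"
  assumes support: "\<And>i t. t \<notin> {0<..<r} \<Longrightarrow> f i t = 0" and "tensor f x \<noteq> 0"
  shows "norm x \<le> r * real CARD('n)"
proof -
  have "x $ i \<in> {0<..<r}" for i
    using assms(2) support[of "x $ i" i] by (auto simp: tensor_def)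
  then have "(\<Sum>i\<in>UNIV. \<bar>x $ i\<bar>) \<le> (\<Sum>i\<in>(UNIV::'n set). r)"
    by (intro sum_mono) (simp add: less_imp_le)
  with norm_le_l1_cart[of x] show ?thesis by (simp add: mult.commute)
qed

lemma tensor_add_axis:
  fixes f :: "'n::finite \<Rightarrow> real \<Rightarrow> 'a::idom"
  shows "tensor f (x + s *\<^sub>R axis i 1) = f i (x $ i + s) * (\<Prod>j\<in>UNIV - {i}. f j (x $ j))"
proof -
  have "tensor f (x + s *\<^sub>R axis i 1) =
      f i (x $ i + s) * (\<Prod>j\<in>UNIV - {i}. f j ((x + s *\<^sub>R axis i 1) $ j))"
    using tensor_fun_upd[of f i "f i" "x + s *\<^sub>R axis i 1"] by simp
  also have "(\<Prod>j\<in>UNIV - {i}. f j ((x + s *\<^sub>R axis i 1) $ j)) = (\<Prod>j\<in>UNIV - {i}. f j (x $ j))"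
    by (rule prod.cong) (auto simp: axis_def)
  finally show ?thesis .
qed

lemma dominated_derivative_tensor:
  fixes f :: "'n::finite \<Rightarrow> real \<Rightarrow> complex"
  assumes f_i_deriv: "dominated_derivative 1 (f i) f' (\<lambda>_. L)"
    and [measurable]: "\<And>j. f j \<in> borel_measurable borel"
    and bounded: "\<And>j t. cmod (f j t) \<le> B"
  shows "dominated_derivative (axis i 1) (tensor f) (tensor (f(i := f')))
    (\<lambda>_. L * B ^ (CARD('n) - 1))"
proof -
  let ?e = "axis i 1 :: real^'n"
  define P where "P x = (\<Prod>j\<in>UNIV - {i}. f j (x $ j))" for x
  have shift: "tensor f (x + s *\<^sub>R ?e) = f i (x $ i + s) * P x" for x s
    unfolding P_def by (rule tensor_add_axis)
  have P_le: "cmod (P x) \<le> B ^ (CARD('n) - 1)" for x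
  proof -
    have "cmod (P x) \<le> (\<Prod>j\<in>UNIV - {i}. B)"
      unfolding P_def prod_norm[symmetric] using bounded by (intro prod_mono) auto
    then show ?thesis by (simp add: card_Diff_singleton)
  qed
  have "cmod (tensor f (x + s *\<^sub>R ?e) - tensor f x) \<le> \<bar>s\<bar> * (L * B ^ (CARD('n) - 1))"
    if "\<bar>s\<bar> \<le> 1" for x s
  proof -
    have "cmod (tensor f (x + s *\<^sub>R ?e) - tensor f x) =
        cmod (f i (x $ i + s) - f i (x $ i)) * cmod (P x)"
      using shift[of x s] shift[of x 0] by (simp add: left_diff_distrib flip: norm_mult)
    also have "\<dots> \<le> (\<bar>s\<bar> * L) * B ^ (CARD('n) - 1)"
      using dominated_derivativeD(1)[OF f_i_deriv that, of "x $ i"] P_le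
      by (intro mult_mono) (auto intro: order_trans[OF norm_ge_zero])
    finally show ?thesis by (simp add: mult.assoc)
  qed
  moreover have "AE x in lborel.
      ((\<lambda>s. tensor f (x + s *\<^sub>R ?e)) has_vector_derivative tensor (f(i := f')) x) (at 0)"
    using AE_lborel_component[OF dominated_derivativeD(2)[OF f_i_deriv], where i=i]
    unfolding shift tensor_fun_upd P_def[symmetric]
    by eventually_elim (auto intro!: derivative_eq_intros)
  moreover have "tensor (f(i := f')) \<in> borel_measurable borel"
    using dominated_derivative_measurable(2)[OF f_i_deriv] by (intro borel_measurable_tensor) simp
  ultimately show ?thesis by (simp add: dominated_derivative_def)
qed

section \<open>Finite differences\<close>

lemma dominated_derivative_cmult:
  assumes u_deriv: "dominated_derivative e u u' U"
  shows "dominated_derivative e (\<lambda>x. c * u x) (\<lambda>x. c * u' x) (\<lambda>x. cmod c * U x)"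
proof -
  have "cmod (c * u (x + s *\<^sub>R e) - c * u x) \<le> \<bar>s\<bar> * (cmod c * U x)" if "\<bar>s\<bar> \<le> 1" for x s
    using mult_left_mono[OF dominated_derivativeD(1)[OF u_deriv that, of x], of "cmod c"]
    by (simp add: norm_mult mult.left_commute flip: right_diff_distrib)
  moreover have "AE x in lborel. ((\<lambda>s. c * u (x + s *\<^sub>R e)) has_vector_derivative c * u' x) (at 0)"
    using dominated_derivativeD(2)[OF u_deriv]
    by eventually_elim (rule has_vector_derivative_mult_right)
  ultimately show ?thesis
    using dominated_derivative_measurable[OF u_deriv] by (simp add: dominated_derivative_def)
qed

lemma dominated_derivative_sum:
  assumes "finite J" and u_deriv: "\<And>j. j \<in> J \<Longrightarrow> dominated_derivative e (u j) (u' j) (U j)"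
  shows "dominated_derivative e (\<lambda>x. \<Sum>j\<in>J. u j x) (\<lambda>x. \<Sum>j\<in>J. u' j x) (\<lambda>x. \<Sum>j\<in>J. U j x)"
proof -
  have "cmod ((\<Sum>j\<in>J. u j (x + s *\<^sub>R e)) - (\<Sum>j\<in>J. u j x)) \<le> \<bar>s\<bar> * (\<Sum>j\<in>J. U j x)" if "\<bar>s\<bar> \<le> 1" for x s
    unfolding sum_subtractf[symmetric] sum_distrib_left
    by (intro sum_norm_le dominated_derivativeD(1)[OF u_deriv that])
  moreover have "AE x in lborel. \<forall>j\<in>J. ((\<lambda>s. u j (x + s *\<^sub>R e)) has_vector_derivative u' j x) (at 0)"
    using \<open>finite J\<close> by (intro AE_finite_allI dominated_derivativeD(2)[OF u_deriv])
  then have "AE x in lborel.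
      ((\<lambda>s. \<Sum>j\<in>J. u j (x + s *\<^sub>R e)) has_vector_derivative (\<Sum>j\<in>J. u' j x)) (at 0)"
    by eventually_elim (intro has_vector_derivative_sum, simp)
  ultimately show ?thesis
    using dominated_derivative_measurable[OF u_deriv] by (simp add: dominated_derivative_def)
qed

lemma dominated_derivative_translate:
  assumes "dominated_derivative e u u' U"
  shows "dominated_derivative e (\<lambda>x. u (x - a)) (\<lambda>x. u' (x - a)) (\<lambda>x. U (x - a))"
proof -
  have commute: "x + s *\<^sub>R e - a = x - a + s *\<^sub>R e" for x s by simp
  note [measurable] = dominated_derivative_measurable[OF assms]
  have "AE x in distr lborel borel ((+) (- a)).
      ((\<lambda>s. u (x + s *\<^sub>R e)) has_vector_derivative u' x) (at 0)"
    using dominated_derivativeD(2)[OF assms] by (subst lborel_distr_plus)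
  then have "AE x in lborel. ((\<lambda>s. u (x + s *\<^sub>R e - a)) has_vector_derivative u' (x - a)) (at 0)"
    unfolding commute by (auto dest!: AE_distrD[rotated])
  moreover have "cmod (u (x + s *\<^sub>R e - a) - u (x - a)) \<le> \<bar>s\<bar> * U (x - a)" if "\<bar>s\<bar> \<le> 1" for x s
    unfolding commute using that by (rule dominated_derivativeD(1)[OF assms])
  ultimately show ?thesis by (simp add: dominated_derivative_def)
qed

lemma dominated_derivative_support:
  assumes u_deriv: "dominated_derivative e u u' (\<lambda>_. L)" and B_borel: "B \<in> sets borel"
    and support: "\<And>x s. x \<notin> B \<Longrightarrow> \<bar>s\<bar> \<le> 1 \<Longrightarrow> u (x + s *\<^sub>R e) = 0"
  shows "dominated_derivative e u u' (\<lambda>x. L * indicator B x)"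
proof -
  have "cmod (u (x + s *\<^sub>R e) - u x) \<le> \<bar>s\<bar> * (L * indicator B x)" if "\<bar>s\<bar> \<le> 1" for x s
    using dominated_derivativeD(1)[OF u_deriv that, of x] support[of x s] support[of x 0] that
    by (cases "x \<in> B") auto
  then show ?thesis
    using u_deriv B_borel by (simp add: dominated_derivative_def)
qed

definition finite_difference :: "real \<Rightarrow> nat \<Rightarrow> (real \<Rightarrow> complex) \<Rightarrow> real \<Rightarrow> complex" where
  "finite_difference \<delta> k u t = (\<Sum>j\<le>k. ((-1) ^ (k - j) * of_nat (k choose j)) * u (t - real j * \<delta>))"

lemma finite_difference_measurable [measurable]:
  assumes [measurable]: "u \<in> borel_measurable borel"
  shows "finite_difference \<delta> k u \<in> borel_measurable borel"
  unfolding finite_difference_def by measurable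

lemma finite_difference_outside:
  assumes support: "\<And>t. t \<notin> {0<..<\<delta>} \<Longrightarrow> u t = 0" and "\<delta> > 0" "t \<notin> {0<..<real (Suc k) * \<delta>}"
  shows "finite_difference \<delta> k u t = 0"
  unfolding finite_difference_def
proof (intro sum.neutral ballI)
  fix j assume "j \<in> {..k}"
  then have "real j * \<delta> + \<delta> \<le> real (Suc k) * \<delta>"
    using \<open>\<delta> > 0\<close> mult_right_mono[of "real (Suc j)" "real (Suc k)" \<delta>] by (simp add: algebra_simps)
  moreover have "0 \<le> real j * \<delta>" using \<open>\<delta> > 0\<close> by simp
  ultimately have "t - real j * \<delta> \<notin> {0<..<\<delta>}"
    using assms(3) unfolding greaterThanLessThan_iff by linarith
  then show "((-1) ^ (k - j) * of_nat (k choose j)) * u (t - real j * \<delta>) = 0"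
    by (simp add: support)
qed

lemma finite_difference_integrable:
  assumes "integrable lborel u"
  shows "integrable lborel (finite_difference \<delta> k u)"
proof -
  have "integrable lborel (\<lambda>t. u (t - a))" for a
    using lborel_integrable_real_affine[OF assms, of 1 "- a"] by simp
  then show ?thesis
    unfolding finite_difference_def
    by (intro Bochner_Integration.integrable_sum integrable_mult_right)
qed

lemma norm_finite_difference_le:
  assumes "\<And>t. cmod (u t) \<le> B"
  shows "cmod (finite_difference \<delta> k u t) \<le> 2 ^ k * B"
proof -
  have "cmod (finite_difference \<delta> k u t) \<le> (\<Sum>j\<le>k. real (k choose j) * B)"
    unfolding finite_difference_def
    by (intro sum_norm_le) (auto simp: norm_mult norm_power intro!: mult_left_mono assms)
  also have "\<dots> = 2 ^ k * B"
    by (simp add: choose_row_sum flip: sum_distrib_right of_nat_sum)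
  finally show ?thesis .
qed

lemma dominated_derivative_finite_difference:
  assumes u_deriv: "dominated_derivative 1 u u' (\<lambda>_. L)"
  shows "dominated_derivative 1 (finite_difference \<delta> k u) (finite_difference \<delta> k u')
    (\<lambda>_. 2 ^ k * L)"
proof -
  have "dominated_derivative 1 (finite_difference \<delta> k u) (finite_difference \<delta> k u')
      (\<lambda>_. \<Sum>j\<le>k. cmod ((-1) ^ (k - j) * of_nat (k choose j)) * L)"
    unfolding finite_difference_def
    by (intro dominated_derivative_sum dominated_derivative_cmult
        dominated_derivative_translate[OF u_deriv] finite_atMost)
  moreover have "(\<Sum>j\<le>k. cmod ((-1) ^ (k - j) * of_nat (k choose j)) * L) = 2 ^ k * L"
    by (simp add: norm_mult norm_power choose_row_sum flip: sum_distrib_right of_nat_sum)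
  ultimately show ?thesis by simp
qed

lemma fourier_finite_difference:
  assumes u_integrable: "integrable lborel u"
  shows "fourier (finite_difference \<delta> k u) \<xi> = (cis (\<xi> * \<delta>) - 1) ^ k * fourier u \<xi>"
proof -
  have "integrable lborel (\<lambda>t. u (t - a))" for a
    using lborel_integrable_real_affine[OF u_integrable, of 1 "- a"] by simp
  then have "fourier (finite_difference \<delta> k u) \<xi> =
      (\<Sum>j\<le>k. ((-1) ^ (k - j) * of_nat (k choose j)) * (cis (\<xi> * (real j * \<delta>)) * fourier u \<xi>))"
    unfolding finite_difference_def using u_integrable
    by (subst fourier_sum) (auto simp: fourier_cmult fourier_translate)
  also have "\<dots> = (\<Sum>j\<le>k. of_nat (k choose j) * cis (\<xi> * \<delta>) ^ j * (-1) ^ (k - j)) * fourier u \<xi>"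
    unfolding sum_distrib_right by (intro sum.cong refl) (simp add: Complex.DeMoivre mult_ac)
  also have "(\<Sum>j\<le>k. of_nat (k choose j) * cis (\<xi> * \<delta>) ^ j * (-1) ^ (k - j)) = (cis (\<xi> * \<delta>) - 1) ^ k"
    using binomial_ring[of "cis (\<xi> * \<delta>)" "-1" k] by simp
  finally show ?thesis .
qed

text \<open>The translates of \<open>u\<close> have disjoint supports.\<close>

lemma norm_finite_difference_square:
  assumes support: "\<And>t. t \<notin> {0<..<\<delta>} \<Longrightarrow> u t = 0"
  shows "(cmod (finite_difference \<delta> k u t))\<^sup>2 =
    (\<Sum>j\<le>k. (real (k choose j))\<^sup>2 * (cmod (u (t - real j * \<delta>)))\<^sup>2)"
proof -
  define v where "v j = ((-1) ^ (k - j) * of_nat (k choose j)) * u (t - real j * \<delta>)" for j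
  have disjoint: "v i = 0 \<or> v j = 0" if "i < j" for i j
  proof (rule disjCI, rule ccontr)
    assume "v j \<noteq> 0" "v i \<noteq> 0"
    then have "0 < t - real j * \<delta>" "t - real i * \<delta> < \<delta>" "0 < \<delta>"
      using support[of "t - real j * \<delta>"] support[of "t - real i * \<delta>"] by (force simp: v_def)+
    moreover have "real i * \<delta> + \<delta> \<le> real j * \<delta>"
      using that \<open>0 < \<delta>\<close> mult_right_mono[of "real (Suc i)" "real j" \<delta>] by (simp add: algebra_simps)
    ultimately show False by linarith
  qed
  have "(cmod (\<Sum>j\<le>k. v j))\<^sup>2 = (\<Sum>j\<le>k. (cmod (v j))\<^sup>2)"
  proof (cases "\<exists>j\<le>k. v j \<noteq> 0")
    case True
    then obtain j where v_j_nonzero: "j \<le> k" "v j \<noteq> 0" by blast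
    have "v i = 0" if "i \<noteq> j" for i
      using that v_j_nonzero disjoint[of i j] disjoint[of j i] by (auto simp: neq_iff)
    then have v_single: "v = (\<lambda>i. if i = j then v j else 0)" by auto
    show ?thesis
      using v_j_nonzero
      by (subst (1 2) v_single)
        (simp add: if_distrib[of cmod] if_distrib[of "\<lambda>x. x\<^sup>2"] cong: if_cong)
  qed simp
  then show ?thesis
    by (simp add: v_def finite_difference_def norm_mult norm_power power_mult_distrib)
qed

lemma
  assumes u_L2: "u \<in> L2 lborel" and support: "\<And>t. t \<notin> {0<..<\<delta>} \<Longrightarrow> u t = 0"
  shows finite_difference_L2: "finite_difference \<delta> k u \<in> L2 lborel"
    and L2_norm_finite_difference:
      "L2_norm lborel (finite_difference \<delta> k u) = sqrt (real (2 * k choose k)) * L2_norm lborel u"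
proof -
  have u_square: "integrable lborel (\<lambda>t. (cmod (u t))\<^sup>2)"
    and u_measurable: "u \<in> borel_measurable borel"
    using u_L2 by (auto simp: L2_def)
  have translate: "integrable lborel (\<lambda>t. (cmod (u (t - a)))\<^sup>2)"
    "(LINT t|lborel. (cmod (u (t - a)))\<^sup>2) = (L2_norm lborel u)\<^sup>2" for a
    using lborel_integrable_real_affine[OF u_square, of 1 "- a"]
      integral_lborel_translate[of "\<lambda>t. (cmod (u t))\<^sup>2" "- a"] u_measurable
    by (simp_all add: L2_norm_square)
  have square: "(cmod (finite_difference \<delta> k u t))\<^sup>2 =
      (\<Sum>j\<le>k. (real (k choose j))\<^sup>2 * (cmod (u (t - real j * \<delta>)))\<^sup>2)" for t
    using support by (rule norm_finite_difference_square)
  show "finite_difference \<delta> k u \<in> L2 lborel"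
    using u_measurable translate(1) by (simp add: L2_def square)
  have "(L2_norm lborel (finite_difference \<delta> k u))\<^sup>2 =
      (\<Sum>j\<le>k. (real (k choose j))\<^sup>2) * (L2_norm lborel u)\<^sup>2"
    unfolding L2_norm_square[of _ "finite_difference \<delta> k u"] square
    using translate by (simp add: Bochner_Integration.integral_sum sum_distrib_right)
  also have "(\<Sum>j\<le>k. (real (k choose j))\<^sup>2) = real (2 * k choose k)"
    unfolding choose_square_sum[symmetric] by simp
  finally have "(L2_norm lborel (finite_difference \<delta> k u))\<^sup>2 =
      (sqrt (real (2 * k choose k)) * L2_norm lborel u)\<^sup>2"
    by (simp add: power_mult_distrib)
  then show "L2_norm lborel (finite_difference \<delta> k u) =
      sqrt (real (2 * k choose k)) * L2_norm lborel u"
    by simp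
qed

section \<open>The sine arch\<close>

definition sine_arch :: "real \<Rightarrow> real \<Rightarrow> complex" where
  "sine_arch \<delta> t = of_real (indicator {0<..<\<delta>} t * sin (pi / \<delta> * t))"

definition sine_arch_deriv :: "real \<Rightarrow> real \<Rightarrow> complex" where
  "sine_arch_deriv \<delta> t = of_real (indicator {0<..<\<delta>} t * (pi / \<delta> * cos (pi / \<delta> * t)))"

lemma borel_measurable_sine_arch [measurable]:
  "sine_arch \<delta> \<in> borel_measurable borel" "sine_arch_deriv \<delta> \<in> borel_measurable borel"
  unfolding sine_arch_def sine_arch_deriv_def by measurable

lemma sine_arch_outside:
  "t \<notin> {0<..<\<delta>} \<Longrightarrow> sine_arch \<delta> t = 0" "t \<notin> {0<..<\<delta>} \<Longrightarrow> sine_arch_deriv \<delta> t = 0"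
  by (simp_all add: sine_arch_def sine_arch_deriv_def)

lemma norm_sine_arch_le: "cmod (sine_arch \<delta> t) \<le> 1"
  by (simp add: sine_arch_def indicator_def)

lemma norm_sine_arch_deriv_le: "\<delta> > 0 \<Longrightarrow> cmod (sine_arch_deriv \<delta> t) \<le> pi / \<delta>"
  unfolding sine_arch_deriv_def norm_of_real abs_mult
  by (auto simp: indicator_def intro!: divide_right_mono mult_left_le)

text \<open>Since the sine vanishes at both end points, cutting off amounts to clamping the argument.\<close>

lemma sine_arch_clamp:
  "\<delta> > 0 \<Longrightarrow> sine_arch \<delta> t = of_real (sin (pi / \<delta> * max 0 (min \<delta> t)))"
  by (auto simp: sine_arch_def indicator_def max_def min_def)

lemma sine_arch_lipschitz:
  assumes "\<delta> > 0"
  shows "cmod (sine_arch \<delta> s - sine_arch \<delta> t) \<le> pi / \<delta> * \<bar>s - t\<bar>"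
proof -
  define clamp where "clamp t = max 0 (min \<delta> t)" for t :: real
  have "cmod (sine_arch \<delta> s - sine_arch \<delta> t) = \<bar>sin (pi / \<delta> * clamp s) - sin (pi / \<delta> * clamp t)\<bar>"
    by (simp add: sine_arch_clamp[OF assms] clamp_def flip: of_real_diff)
  also have "\<dots> \<le> \<bar>pi / \<delta> * clamp s - pi / \<delta> * clamp t\<bar>"
    using field_differentiable_bound[of UNIV sin cos 1 "pi / \<delta> * clamp s" "pi / \<delta> * clamp t"]
    by (simp add: DERIV_sin)
  also have "\<dots> = pi / \<delta> * \<bar>clamp s - clamp t\<bar>"
    unfolding right_diff_distrib[symmetric] abs_mult using assms by simp
  also have "\<dots> \<le> pi / \<delta> * \<bar>s - t\<bar>"
    using assms by (intro mult_left_mono) (auto simp: clamp_def)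
  finally show ?thesis .
qed

lemma sine_arch_has_vector_derivative:
  assumes "t \<noteq> 0" "t \<noteq> \<delta>"
  shows "(sine_arch \<delta> has_vector_derivative sine_arch_deriv \<delta> t) (at t)"
proof (cases "t \<in> {0<..<\<delta>}")
  case True
  have "((\<lambda>t. of_real (sin (pi / \<delta> * t))) has_vector_derivative sine_arch_deriv \<delta> t) (at t)"
    unfolding sine_arch_deriv_def using True
    by (intro has_vector_derivative_of_real)
      (auto intro!: derivative_eq_intros simp flip: has_real_derivative_iff_has_vector_derivative)
  then show ?thesis
    by (rule has_vector_derivative_transform_within_open[OF _ _ True]) (auto simp: sine_arch_def)
next
  case False
  then have outside: "t \<in> - {0..\<delta>}" using assms by force
  have "((\<lambda>t. 0) has_vector_derivative sine_arch_deriv \<delta> t) (at t)"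
    using sine_arch_outside(2)[OF False] by simp
  then show ?thesis
    by (rule has_vector_derivative_transform_within_open[OF _ _ outside]) (auto simp: sine_arch_def)
qed

lemma dominated_derivative_sine_arch:
  assumes "\<delta> > 0"
  shows "dominated_derivative 1 (sine_arch \<delta>) (sine_arch_deriv \<delta>) (\<lambda>_. pi / \<delta>)"
proof -
  have deriv: "((\<lambda>s. sine_arch \<delta> (t + s *\<^sub>R 1)) has_vector_derivative sine_arch_deriv \<delta> t) (at 0)"
    if "t \<noteq> 0" "t \<noteq> \<delta>" for t
    using sine_arch_has_vector_derivative[OF that]
    by (simp add: has_vector_derivative_def has_derivative_at add.commute)
  have "AE t in lborel.
      ((\<lambda>s. sine_arch \<delta> (t + s *\<^sub>R 1)) has_vector_derivative sine_arch_deriv \<delta> t) (at 0)"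
    using AE_lborel_singleton[of 0] AE_lborel_singleton[of \<delta>] by eventually_elim (rule deriv)
  with sine_arch_lipschitz[OF assms, of "t + s" t for s t] show ?thesis
    by (simp add: dominated_derivative_def mult.commute)
qed

lemma integral_1_plus_cos_double:
  assumes "\<delta> > 0"
  shows "(LINT t|lborel. indicator {0..\<delta>} t *\<^sub>R ((1 + c * cos (2 * (pi / \<delta> * t))) / 2)) = \<delta> / 2"
proof -
  define w where "w = pi / \<delta>"
  have frequency: "w \<noteq> 0" "sin (2 * (w * \<delta>)) = 0" using assms by (simp_all add: w_def)
  let ?G = "\<lambda>t. t / 2 + c / (4 * w) * sin (2 * (w * t))"
  have "(LINT t|lborel. indicator {0..\<delta>} t *\<^sub>R ((1 + c * cos (2 * (w * t))) / 2)) = ?G \<delta> - ?G 0"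
  proof (rule integral_FTC_atLeastAtMost)
    show "(?G has_vector_derivative (1 + c * cos (2 * (w * t))) / 2) (at t within {0..\<delta>})" for t
      unfolding has_real_derivative_iff_has_vector_derivative[symmetric] using frequency(1)
      by (auto intro!: derivative_eq_intros simp: field_simps)
  qed (use assms in \<open>auto intro!: continuous_intros\<close>)
  then show ?thesis unfolding w_def[symmetric] using frequency(2) by simp
qed

lemma
  assumes "\<delta> > 0"
  shows L2_norm_sine_arch: "L2_norm lborel (sine_arch \<delta>) = sqrt (\<delta> / 2)"
    and L2_norm_sine_arch_deriv: "L2_norm lborel (sine_arch_deriv \<delta>) = pi / \<delta> * sqrt (\<delta> / 2)"
proof -
  define w where "w = pi / \<delta>"
  define C where "C c t = indicator {0..\<delta>} t *\<^sub>R ((1 + c * cos (2 * (w * t))) / 2)" for c t :: real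
  have integral_C: "(LINT t|lborel. C c t) = \<delta> / 2" for c
    using integral_1_plus_cos_double[OF assms, of c] by (simp add: C_def w_def)
  have [measurable]: "C c \<in> borel_measurable borel" for c unfolding C_def by measurable
  have AE_ne: "AE t in lborel. t \<noteq> 0 \<and> t \<noteq> \<delta>"
    using AE_lborel_singleton[of 0] AE_lborel_singleton[of \<delta>] by eventually_elim simp
  have "(cmod (sine_arch \<delta> t))\<^sup>2 = C (- 1) t" if "t \<noteq> 0 \<and> t \<noteq> \<delta>" for t
    using that cos_double_sin[of "w * t"]
    unfolding sine_arch_def norm_of_real power2_abs w_def[symmetric]
    by (auto simp: C_def indicator_def)
  then have "(LINT t|lborel. (cmod (sine_arch \<delta> t))\<^sup>2) = (LINT t|lborel. C (- 1) t)"
    using AE_ne by (intro integral_cong_AE) (auto elim: eventually_mono)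
  then show "L2_norm lborel (sine_arch \<delta>) = sqrt (\<delta> / 2)"
    by (simp only: L2_norm_def integral_C)
  have "(cmod (sine_arch_deriv \<delta> t))\<^sup>2 = w\<^sup>2 * C 1 t" if "t \<noteq> 0 \<and> t \<noteq> \<delta>" for t
    using that cos_double_cos[of "w * t"]
    unfolding sine_arch_deriv_def norm_of_real power2_abs w_def[symmetric]
    by (auto simp: C_def indicator_def power_mult_distrib)
  then have "(LINT t|lborel. (cmod (sine_arch_deriv \<delta> t))\<^sup>2) = (LINT t|lborel. w\<^sup>2 * C 1 t)"
    using AE_ne by (intro integral_cong_AE) (auto elim: eventually_mono)
  then have "L2_norm lborel (sine_arch_deriv \<delta>) = sqrt (w\<^sup>2 * (\<delta> / 2))"
    by (simp only: L2_norm_def integral_mult_right_zero integral_C)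
  also have "\<dots> = w * sqrt (\<delta> / 2)"
    using assms by (simp only: real_sqrt_mult real_sqrt_abs) (simp add: w_def)
  finally show "L2_norm lborel (sine_arch_deriv \<delta>) = pi / \<delta> * sqrt (\<delta> / 2)"
    by (simp add: w_def)
qed

lemma
  assumes [measurable]: "u \<in> borel_measurable borel" and bounded: "\<And>t. cmod (u t) \<le> B"
    and support: "\<And>t. t \<notin> {a<..<b} \<Longrightarrow> u t = 0" and "a \<le> b"
  shows L2_interval_support: "u \<in> L2 lborel" and integrable_interval_support: "integrable lborel u"
    and integral_norm_interval_support_le: "(LINT t|lborel. cmod (u t)) \<le> B * (b - a)"
proof -
  have finite: "emeasure lborel {a<..<b} < \<infinity>" using \<open>a \<le> b\<close> by simp
  show "u \<in> L2 lborel"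
    using assms finite by (intro L2_finite_support[of _ _ "{a<..<b}" B]) auto
  show "integrable lborel u"
    using assms finite by (intro integrableI_bounded_set[of "{a<..<b}" _ _ B]) auto
  then have "(LINT t|lborel. cmod (u t)) \<le> (LINT t|lborel. B * indicator {a<..<b} t)"
    using assms finite
    by (intro integral_mono integrable_norm integrable_mult_right integrable_real_indicator)
      (auto simp: indicator_def)
  also have "\<dots> = B * (b - a)" using \<open>a \<le> b\<close> by simp
  finally show "(LINT t|lborel. cmod (u t)) \<le> B * (b - a)" .
qed

lemma
  assumes "\<delta> > 0"
  shows sine_arch_integrable: "integrable lborel (sine_arch \<delta>)"
    and sine_arch_L2: "sine_arch \<delta> \<in> L2 lborel"
    and sine_arch_deriv_L2: "sine_arch_deriv \<delta> \<in> L2 lborel"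
proof -
  note norms = norm_sine_arch_le norm_sine_arch_deriv_le[OF assms]
  show "integrable lborel (sine_arch \<delta>)"
    using assms norms by (auto intro!: integrable_interval_support[of _ _ 0 \<delta>] sine_arch_outside)
  show "sine_arch \<delta> \<in> L2 lborel" "sine_arch_deriv \<delta> \<in> L2 lborel"
    using assms norms by (auto intro!: L2_interval_support[of _ _ 0 \<delta>] sine_arch_outside)
qed

lemma fourier_sine_arch_le:
  assumes "\<delta> > 0"
  shows "cmod (fourier (sine_arch \<delta>) \<xi>) \<le> \<delta>" and "\<bar>\<xi>\<bar> * cmod (fourier (sine_arch \<delta>) \<xi>) \<le> pi"
proof -
  have "(LINT t|lborel. cmod (sine_arch \<delta> t)) \<le> 1 * (\<delta> - 0)"
    using assms
    by (intro integral_norm_interval_support_le norm_sine_arch_le sine_arch_outside) simp_all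
  then show "cmod (fourier (sine_arch \<delta>) \<xi>) \<le> \<delta>"
    using order_trans[OF norm_fourier_le] by simp
  have "dominated_derivative 1 (sine_arch \<delta>) (sine_arch_deriv \<delta>)
      (\<lambda>t. pi / \<delta> * indicator {-1..\<delta> + 1} t)"
    by (intro dominated_derivative_support[OF dominated_derivative_sine_arch[OF assms]])
      (auto intro!: sine_arch_outside)
  then have "fourier (sine_arch_deriv \<delta>) \<xi> = - (\<i> * of_real \<xi>) * fourier (sine_arch \<delta>) \<xi>"
    using assms by (subst fourier_dominated_derivative)
      (auto intro!: sine_arch_integrable integrable_real_indicator simp: emeasure_lborel_Icc_eq)
  then have "\<bar>\<xi>\<bar> * cmod (fourier (sine_arch \<delta>) \<xi>) = cmod (fourier (sine_arch_deriv \<delta>) \<xi>)"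
    by (simp add: norm_mult)
  also have "\<dots> \<le> pi / \<delta> * (\<delta> - 0)"
    using assms
    by (intro order_trans[OF norm_fourier_le] integral_norm_interval_support_le)
      (auto intro: norm_sine_arch_deriv_le sine_arch_outside)
  finally show "\<bar>\<xi>\<bar> * cmod (fourier (sine_arch \<delta>) \<xi>) \<le> pi" using assms by simp
qed

section \<open>Small data\<close>

definition small_data :: "real \<Rightarrow> real \<Rightarrow> (real^'n::finite \<Rightarrow> complex) set" where
  "small_data \<kappa> t = {h \<in> H1_ball. H1_norm h \<le> 1 \<and> HS_norm sphere_measure (F_op \<kappa> h) \<le> t}"

lemma L2_norm_le_modulus:
  fixes h :: "real^'n \<Rightarrow> complex"
  assumes "mono_on {0..} \<omega>"
    and "\<And>h :: real^'n \<Rightarrow> complex. h \<in> H1_ball \<Longrightarrow> H1_norm h \<le> 1 \<Longrightarrow>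
      L2_norm lborel h \<le> \<omega> (HS_norm sphere_measure (F_op \<kappa> h))"
    and h_small: "h \<in> small_data \<kappa> t"
  shows "L2_norm lborel h \<le> \<omega> t"
proof -
  let ?s = "HS_norm sphere_measure (F_op \<kappa> h)"
  have "L2_norm lborel h \<le> \<omega> ?s" using assms by (simp add: small_data_def)
  also have "\<dots> \<le> \<omega> t"
    using h_small HS_norm_nonneg[of sphere_measure "F_op \<kappa> h"]
    by (intro mono_onD[OF assms(1)]) (auto simp: small_data_def)
  finally show ?thesis .
qed

section \<open>Witnesses\<close>

definition witness :: "real \<Rightarrow> nat \<Rightarrow> real^'n::finite \<Rightarrow> complex" where
  "witness \<delta> k = tensor (\<lambda>_. finite_difference \<delta> k (sine_arch \<delta>))"

context
  fixes \<delta> :: real and k :: nat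
  assumes \<delta>_pos: "0 < \<delta>"
begin

lemma witness_outside:
  assumes "real (Suc k) * \<delta> * real CARD('n::finite) < 1" and "x \<notin> ball 0 1"
  shows "witness \<delta> k (x :: real^'n) = 0"
proof (rule ccontr)
  assume "witness \<delta> k x \<noteq> 0"
  then have "norm x \<le> real (Suc k) * \<delta> * real CARD('n)"
    unfolding witness_def
    by (rule tensor_nonzero_imp_norm_le[rotated])
      (rule finite_difference_outside[OF sine_arch_outside(1) \<delta>_pos])
  then show False using assms by simp
qed

lemma sine_difference_L2:
  "finite_difference \<delta> k (sine_arch \<delta>) \<in> L2 lborel"
  "finite_difference \<delta> k (sine_arch_deriv \<delta>) \<in> L2 lborel"
  by (rule finite_difference_L2;
      (rule sine_arch_L2[OF \<delta>_pos] sine_arch_deriv_L2[OF \<delta>_pos] | erule sine_arch_outside))+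

lemma L2_norm_sine_difference:
  "L2_norm lborel (finite_difference \<delta> k (sine_arch \<delta>)) = sqrt (real (2 * k choose k) * (\<delta> / 2))"
proof -
  have "L2_norm lborel (finite_difference \<delta> k (sine_arch \<delta>)) =
      sqrt (real (2 * k choose k)) * L2_norm lborel (sine_arch \<delta>)"
    by (rule L2_norm_finite_difference[OF sine_arch_L2[OF \<delta>_pos] sine_arch_outside(1)])
  then show ?thesis by (simp only: L2_norm_sine_arch[OF \<delta>_pos] real_sqrt_mult)
qed

lemma L2_norm_sine_difference_deriv:
  "L2_norm lborel (finite_difference \<delta> k (sine_arch_deriv \<delta>)) =
    pi / \<delta> * L2_norm lborel (finite_difference \<delta> k (sine_arch \<delta>))"
proof -
  have "L2_norm lborel (finite_difference \<delta> k (sine_arch_deriv \<delta>)) =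
      sqrt (real (2 * k choose k)) * L2_norm lborel (sine_arch_deriv \<delta>)"
    by (rule L2_norm_finite_difference[OF sine_arch_deriv_L2[OF \<delta>_pos] sine_arch_outside(2)])
  then show ?thesis
    by (simp only: L2_norm_sine_difference L2_norm_sine_arch_deriv[OF \<delta>_pos] real_sqrt_mult mult_ac)
qed

lemma L2_norm_witness:
  "L2_norm lborel (witness \<delta> k :: real^'n \<Rightarrow> complex) =
    sqrt (real (2 * k choose k) * (\<delta> / 2)) ^ CARD('n::finite)"
proof -
  have "L2_norm lborel (witness \<delta> k :: real^'n \<Rightarrow> complex) =
      (\<Prod>i\<in>(UNIV::'n set). L2_norm lborel (finite_difference \<delta> k (sine_arch \<delta>)))"
    unfolding witness_def
    by (intro L2_norm_tensor sine_difference_L2)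
  then show ?thesis
    by (simp only: L2_norm_sine_difference prod_constant)
qed

lemma witness_integrable: "integrable lborel (witness \<delta> k)"
  unfolding witness_def
  by (intro integrable_tensor finite_difference_integrable sine_arch_integrable[OF \<delta>_pos])

lemma witness_H1: "(witness \<delta> k :: real^'n \<Rightarrow> complex) \<in> H1"
  and H1_norm_witness: "H1_norm (witness \<delta> k :: real^'n \<Rightarrow> complex) =
    sqrt (1 + real CARD('n::finite) * (pi / \<delta>)\<^sup>2) *
      L2_norm lborel (witness \<delta> k :: real^'n \<Rightarrow> complex)"
proof -
  let ?h = "witness \<delta> k :: real^'n \<Rightarrow> complex"
  let ?g = "finite_difference \<delta> k (sine_arch \<delta>)"
    and ?g' = "finite_difference \<delta> k (sine_arch_deriv \<delta>)"
  define h' where "h' i = tensor ((\<lambda>_. ?g)(i := ?g'))" for i :: 'n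
  have h_L2: "?h \<in> L2 lborel"
    unfolding witness_def by (intro tensor_L2 sine_difference_L2)
  have h'_L2: "h' i \<in> L2 lborel" for i
    unfolding h'_def using sine_difference_L2 by (intro tensor_L2) simp
  define L where "L = (2 ^ k * (pi / \<delta>)) * (2 ^ k * 1) ^ (CARD('n) - 1)"
  have "dominated_derivative (axis i 1) ?h (h' i) (\<lambda>_. L)" for i
    unfolding witness_def h'_def L_def
    by (intro dominated_derivative_tensor dominated_derivative_finite_difference
        dominated_derivative_sine_arch \<delta>_pos norm_finite_difference_le norm_sine_arch_le
        finite_difference_measurable borel_measurable_sine_arch)
  note H1 = H1_if_dominated[where f="?h" and f'=h' and L="\<lambda>_. L",
      OF h_L2 h'_L2 this witness_integrable]
  show "?h \<in> H1" by (rule H1)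
  have "L2_norm lborel ?h = L2_norm lborel (tensor ((\<lambda>_. ?g)(i := ?g)))" for i :: 'n
    by (simp add: witness_def fun_upd_idem)
  then have h'_norm: "L2_norm lborel (h' i) = pi / \<delta> * L2_norm lborel ?h" for i
    unfolding h'_def
    by (simp only: L2_norm_tensor_fun_upd sine_difference_L2 L2_norm_sine_difference_deriv
        mult.assoc)
  have "H1_norm ?h = sqrt ((1 + real CARD('n) * (pi / \<delta>)\<^sup>2) * (L2_norm lborel ?h)\<^sup>2)"
    unfolding H1(2) h'_norm
    by (simp only: power_mult_distrib sum_constant distrib_right mult_1_left mult.assoc)
  then show "H1_norm ?h = sqrt (1 + real CARD('n) * (pi / \<delta>)\<^sup>2) * L2_norm lborel ?h"
    by (simp add: real_sqrt_mult)
qed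

lemma fourier_witness:
  "fourier (witness \<delta> k) \<xi> = (\<Prod>i\<in>UNIV. (cis (\<xi> $ i * \<delta>) - 1) ^ k * fourier (sine_arch \<delta>) (\<xi> $ i))"
  unfolding witness_def
  by (simp add: fourier_tensor finite_difference_integrable sine_arch_integrable[OF \<delta>_pos]
      fourier_finite_difference)

lemma norm_fourier_witness_le:
  fixes \<xi> :: "real^'n"
  assumes component_le: "\<And>i. \<bar>\<xi> $ i\<bar> \<le> r"
  shows "cmod (fourier (witness \<delta> k) \<xi>) \<le> (\<delta> * (r * \<delta>) ^ k) ^ CARD('n)"
proof -
  have cis: "cmod (cis (\<xi> $ i * \<delta>) - 1) \<le> r * \<delta>" for i
    using \<delta>_pos order_trans[OF norm_cis_minus_1_le, of "\<xi> $ i * \<delta>"]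
      mult_right_mono[OF component_le, of \<delta>]
    by (simp add: abs_mult)
  have "0 \<le> r * \<delta>" using order_trans[OF norm_ge_zero cis] .
  then have "cmod ((cis (\<xi> $ i * \<delta>) - 1) ^ k * fourier (sine_arch \<delta>) (\<xi> $ i)) \<le> (r * \<delta>) ^ k * \<delta>"
    for i
    unfolding norm_mult norm_power
    by (intro mult_mono power_mono cis fourier_sine_arch_le \<delta>_pos) auto
  then have "cmod (fourier (witness \<delta> k) \<xi>) \<le> (\<Prod>i\<in>(UNIV::'n set). (r * \<delta>) ^ k * \<delta>)"
    unfolding fourier_witness prod_norm[symmetric] by (intro prod_mono) auto
  then show ?thesis by (simp add: mult.commute)
qed

end

lemma norm_fourier_witness_0_square_le:
  fixes \<xi> :: "real^'n"
  assumes step: "0 < \<delta>" "\<delta> \<le> 1"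
  shows "(cmod (fourier (witness \<delta> 0) \<xi>))\<^sup>2 \<le> (1 + pi\<^sup>2) ^ CARD('n) * cauchy_weight \<xi>"
proof -
  have arch: "(cmod (fourier (sine_arch \<delta>) s))\<^sup>2 \<le> (1 + pi\<^sup>2) * inverse (1 + s\<^sup>2)" for s
  proof -
    let ?I = "cmod (fourier (sine_arch \<delta>) s)"
    have "(1 + s\<^sup>2) * ?I\<^sup>2 = ?I\<^sup>2 + (\<bar>s\<bar> * ?I)\<^sup>2"
      by (simp add: power_mult_distrib algebra_simps)
    also have "\<dots> \<le> 1\<^sup>2 + pi\<^sup>2"
      using fourier_sine_arch_le[OF step(1), of s] step(2) by (intro add_mono power_mono) auto
    finally show ?thesis
      by (simp add: pos_le_divide_eq add_pos_nonneg mult.commute flip: divide_inverse)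
  qed
  have "(cmod (fourier (witness \<delta> 0) \<xi>))\<^sup>2 = (\<Prod>i\<in>UNIV. (cmod (fourier (sine_arch \<delta>) (\<xi> $ i)))\<^sup>2)"
    by (simp add: fourier_witness[OF step(1)] prod_norm[symmetric] prod_power_distrib)
  also have "\<dots> \<le> (\<Prod>i\<in>UNIV. (1 + pi\<^sup>2) * inverse (1 + (\<xi> $ i)\<^sup>2))"
    using arch by (intro prod_mono) auto
  finally show ?thesis
    by (simp only: cauchy_weight_def prod.distrib prod_constant)
qed

lemma L2_norm_F_kernel_witness_0_le:
  fixes y :: "real^'n"
  assumes step: "0 < \<delta>" "\<delta> \<le> 1" and \<kappa>_pos: "0 < \<kappa>"
  shows "L2_norm sphere_measure (F_kernel \<kappa> (witness \<delta> 0) y) \<le>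
      sqrt (((1 + pi\<^sup>2) * (3 * pi)) ^ CARD('n))"
proof -
  let ?n = "CARD('n)"
  define A where "A = \<kappa> powr (real ?n - 1) * (1 + pi\<^sup>2) ^ ?n"
  have "(cmod (F_kernel \<kappa> (witness \<delta> 0) y \<theta>))\<^sup>2 \<le> A * cauchy_weight (\<kappa> *\<^sub>R (\<theta> - y))" for \<theta>
  proof -
    have "(\<kappa> powr ((real ?n - 1) / 2))\<^sup>2 = \<kappa> powr (real ?n - 1)"
      by (simp add: power2_eq_square flip: powr_add)
    then show ?thesis
      using norm_fourier_witness_0_square_le[OF step, of "\<kappa> *\<^sub>R (\<theta> - y)"]
      by (simp add: F_kernel_def A_def norm_mult power_mult_distrib mult.assoc mult_left_mono)
  qed
  then have "(LINT \<theta>|sphere_measure. (cmod (F_kernel \<kappa> (witness \<delta> 0) y \<theta>))\<^sup>2) \<le>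
      (LINT \<theta>|sphere_measure. A * cauchy_weight (\<kappa> *\<^sub>R (\<theta> - y)))"
    using integrable_sphere_cauchy_weight[OF \<kappa>_pos, of y]
    by (intro integral_mono') (auto simp: A_def cauchy_weight_nonneg)
  also have "\<dots> \<le> A * (\<kappa> * (3 * pi / \<kappa>) ^ ?n)"
    using integral_sphere_cauchy_weight_le[OF \<kappa>_pos, of y] by (simp add: A_def mult_left_mono)
  also have "\<dots> = (\<kappa> powr (real ?n - 1) * \<kappa> / \<kappa> ^ ?n) * ((1 + pi\<^sup>2) * (3 * pi)) ^ ?n"
    by (simp add: A_def power_divide power_mult_distrib)
  also have "\<kappa> powr (real ?n - 1) * \<kappa> = \<kappa> ^ ?n"
    using \<kappa>_pos by (simp add: powr_diff powr_realpow)
  finally show ?thesis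
    using \<kappa>_pos by (simp add: L2_norm_def)
qed

lemma norm_F_kernel_witness_le:
  fixes y \<theta> :: "real^'n"
  assumes \<delta>_pos: "0 < \<delta>" and \<kappa>_nonneg: "0 \<le> \<kappa>" and "y \<in> sphere 0 1" "\<theta> \<in> sphere 0 1"
  shows "cmod (F_kernel \<kappa> (witness \<delta> k) y \<theta>) \<le>
    \<kappa> powr ((real CARD('n) - 1) / 2) * (\<delta> * (2 * \<kappa> * \<delta>) ^ k) ^ CARD('n)"
proof -
  have "\<bar>(\<kappa> *\<^sub>R (\<theta> - y)) $ i\<bar> \<le> 2 * \<kappa>" for i
  proof -
    have "\<bar>(\<theta> - y) $ i\<bar> \<le> 2"
      using component_le_norm_cart[of "\<theta> - y" i] norm_triangle_ineq4[of \<theta> y] assms(3,4) by simp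
    then show ?thesis
      using \<kappa>_nonneg mult_left_mono[of "\<bar>(\<theta> - y) $ i\<bar>" 2 \<kappa>] by (simp add: abs_mult mult.commute)
  qed
  then show ?thesis
    unfolding F_kernel_def norm_mult norm_of_real
    by (simp add: mult_left_mono norm_fourier_witness_le[OF \<delta>_pos])
qed

lemma scaled_witness_small_data:
  fixes \<delta> :: real and k :: nat
  defines "h \<equiv> witness \<delta> k :: real^'n \<Rightarrow> complex"
  assumes step: "0 < \<delta>" "real (Suc k) * \<delta> * real CARD('n) < 1"
    and scale: "0 \<le> c" "c * H1_norm h \<le> 1"
    and kernel_le: "\<And>y. y \<in> sphere 0 1 \<Longrightarrow> L2_norm sphere_measure (F_kernel \<kappa> h y) \<le> C" "0 \<le> C"
    and data_le: "c * C * sqrt (measure (sphere_measure :: (real^'n) measure) (sphere 0 1)) \<le> t"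
  shows "(\<lambda>x. of_real c * h x) \<in> small_data \<kappa> t"
proof -
  have h_H1: "h \<in> H1" "integrable lborel h" "\<And>x. x \<notin> ball 0 1 \<Longrightarrow> h x = 0"
    using step unfolding h_def by (auto intro: witness_H1 witness_integrable witness_outside)
  then have "(\<lambda>x. of_real c * h x) \<in> H1_ball"
    by (intro H1_ball_if_zero_outside H1_cmult) auto
  moreover have "H1_norm (\<lambda>x. of_real c * h x) \<le> 1"
    using scale by (simp add: H1_norm_cmult[OF h_H1(1)])
  moreover have "HS_norm sphere_measure (F_op \<kappa> (\<lambda>x. of_real c * h x)) \<le> t"
    using HS_norm_F_op_cmult_le[OF h_H1(2,3) kernel_le, of "of_real c"] scale(1) data_le by simp
  ultimately show ?thesis by (simp add: small_data_def)
qed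

lemma exists_linear_witness:
  "\<exists>c>0. \<forall>\<kappa>\<ge>1. \<forall>t. 0 < t \<and> t \<le> 1 \<longrightarrow>
    (\<exists>h \<in> (small_data \<kappa> t :: (real^'n::finite \<Rightarrow> complex) set). c * t \<le> L2_norm lborel h)"
proof -
  let ?n = "real CARD('n)"
  define \<delta> where "\<delta> = 1 / (2 * ?n)"
  have "1 \<le> ?n" by (simp add: Suc_leI)
  then have "1 \<le> 2 * ?n" by linarith
  then have step: "0 < \<delta>" "\<delta> \<le> 1" "\<delta> * ?n < 1" by (simp_all add: \<delta>_def divide_le_eq)
  define w where "w = (witness \<delta> 0 :: real^'n \<Rightarrow> complex)"
  define C where "C = sqrt (((1 + pi\<^sup>2) * (3 * pi)) ^ CARD('n))"
  define \<sigma> where "\<sigma> = measure (sphere_measure :: (real^'n) measure) (sphere 0 1)"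
  define R where "R = 1 + H1_norm w + C * sqrt \<sigma>"
  have "0 \<le> H1_norm w" "0 \<le> C" "0 \<le> \<sigma>"
    by (simp_all add: H1_norm_def C_def \<sigma>_def sum_nonneg)
  then have R_bounds: "0 < R" "H1_norm w \<le> R" "C * sqrt \<sigma> \<le> R"
    by (simp_all add: R_def add_pos_nonneg)
  have w_pos: "0 < L2_norm lborel w"
    using step by (simp add: w_def L2_norm_witness)
  have "\<exists>h \<in> (small_data \<kappa> t :: (real^'n \<Rightarrow> complex) set).
      L2_norm lborel w / R * t \<le> L2_norm lborel h"
    if "\<kappa> \<ge> 1" "0 < t" "t \<le> 1" for \<kappa> t
  proof -
    define c where "c = t / R"
    have scale_nonneg: "0 \<le> c" using R_bounds(1) that by (simp add: c_def)
    have "c * H1_norm w \<le> 1"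
      using R_bounds mult_mono[of t 1 "H1_norm w" R] that \<open>0 \<le> H1_norm w\<close>
      by (simp add: c_def pos_divide_le_eq)
    moreover have "c * C * sqrt \<sigma> \<le> t"
      using R_bounds mult_left_mono[of "C * sqrt \<sigma>" R t] that
      by (simp add: c_def pos_divide_le_eq mult.assoc)
    ultimately have "(\<lambda>x. of_real c * w x) \<in> small_data \<kappa> t"
      using that step scale_nonneg \<open>0 \<le> C\<close> unfolding w_def \<sigma>_def C_def
      by (intro scaled_witness_small_data) (simp_all add: L2_norm_F_kernel_witness_0_le)
    moreover have "L2_norm lborel (\<lambda>x. of_real c * w x) = L2_norm lborel w / R * t"
      using scale_nonneg by (simp add: L2_norm_cmult) (simp add: c_def)
    ultimately show ?thesis by (intro bexI[of _ "\<lambda>x. of_real c * w x"]) simp_all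
  qed
  then show ?thesis
    using w_pos R_bounds(1) by (intro exI[of _ "L2_norm lborel w / R"]) simp
qed

lemma H1_norm_witness_le:
  assumes step: "0 < \<delta>" "\<delta> \<le> 1"
  shows "H1_norm (witness \<delta> k :: real^'n \<Rightarrow> complex) \<le>
    pi * sqrt (1 + real CARD('n::finite)) / \<delta> * L2_norm lborel (witness \<delta> k :: real^'n \<Rightarrow> complex)"
proof -
  let ?n = "real CARD('n)"
  have "1 \<le> (pi / \<delta>)\<^sup>2"
    using step pi_ge_two by (intro one_le_power) (simp add: le_divide_eq)
  then have "sqrt (1 + ?n * (pi / \<delta>)\<^sup>2) \<le> sqrt ((1 + ?n) * (pi / \<delta>)\<^sup>2)"
    by (intro real_sqrt_le_mono) (simp add: distrib_right)
  also have "\<dots> = pi * sqrt (1 + ?n) / \<delta>"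
    using step(1) by (simp add: real_sqrt_mult)
  finally show ?thesis
    unfolding H1_norm_witness[OF step(1)] by (intro mult_right_mono) auto
qed

lemma power_le_L2_norm_witness:
  assumes step: "0 < \<delta>" "\<delta> \<le> 1 / 2"
  shows "\<delta> ^ CARD('n::finite) \<le> L2_norm lborel (witness \<delta> k :: real^'n \<Rightarrow> complex)"
proof -
  have "1 \<le> real (2 * k choose k)"
    by (simp add: Suc_leI zero_less_binomial)
  then have "\<delta> / 2 \<le> real (2 * k choose k) * (\<delta> / 2)"
    using step mult_right_mono[of 1 "real (2 * k choose k)" "\<delta> / 2"] by simp
  moreover have "\<delta>\<^sup>2 \<le> \<delta> / 2"
    using step mult_left_mono[of \<delta> "1 / 2" \<delta>] by (simp add: power2_eq_square)
  ultimately have "\<delta> \<le> sqrt (real (2 * k choose k) * (\<delta> / 2))"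
    by (intro real_le_rsqrt) linarith
  then show ?thesis
    unfolding L2_norm_witness[OF step(1)] using step(1) by (intro power_mono) auto
qed

lemma powr_mult_power_le:
  fixes \<kappa> q :: real
  assumes \<kappa>_ge_1: "1 \<le> \<kappa>" and q_le: "0 \<le> q" "q \<le> exp (- 1)"
  shows "\<kappa> powr ((real n - 1) / 2) * (q ^ k) ^ n \<le> (\<kappa> * exp (- real k)) ^ n"
proof -
  have "\<kappa> powr ((real n - 1) / 2) \<le> \<kappa> powr real n"
    using \<kappa>_ge_1 by (intro powr_mono) auto
  also have "\<dots> = \<kappa> ^ n" using \<kappa>_ge_1 by (simp add: powr_realpow)
  finally have "\<kappa> powr ((real n - 1) / 2) \<le> \<kappa> ^ n" .
  moreover have "q ^ k \<le> exp (- real k)"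
    using power_mono[OF q_le(2,1), of k] by (simp flip: exp_of_nat_mult)
  ultimately show ?thesis
    unfolding power_mult_distrib[of \<kappa>] using \<kappa>_ge_1 q_le(1) by (intro mult_mono power_mono) auto
qed

lemma scaled_witness_small_data_of_decay:
  fixes \<delta> \<kappa> c :: real and k :: nat
  defines "w \<equiv> witness \<delta> k :: real^'n \<Rightarrow> complex"
    and "\<sigma> \<equiv> measure (sphere_measure :: (real^'n) measure) (sphere 0 1)"
  assumes \<kappa>_ge_1: "1 \<le> \<kappa>" and step: "0 < \<delta>" "real (Suc k) * \<delta> * real CARD('n) < 1"
    and decay: "2 * \<kappa> * \<delta> \<le> exp (- 1)"
    and scale: "0 \<le> c" "c * H1_norm w \<le> 1" "c * \<delta> ^ CARD('n) \<le> 1"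
    and data_le: "\<sigma> * (\<kappa> * exp (- real k)) ^ CARD('n) \<le> t"
  shows "(\<lambda>x. of_real c * w x) \<in> small_data \<kappa> t"
proof -
  let ?n = "CARD('n)"
  define C where "C = \<kappa> powr ((real ?n - 1) / 2) * (\<delta> * (2 * \<kappa> * \<delta>) ^ k) ^ ?n"
  have C_nonneg: "0 \<le> C" using \<kappa>_ge_1 step(1) by (simp add: C_def)
  have kernel: "L2_norm sphere_measure (F_kernel \<kappa> w y) \<le> C * sqrt \<sigma>" if "y \<in> sphere 0 1" for y
    using sphere_measure.L2_norm_le[of "F_kernel \<kappa> w y" C]
      norm_F_kernel_witness_le[OF step(1) _ that] \<kappa>_ge_1 C_nonneg
    by (simp add: w_def C_def \<sigma>_def space_sphere_measure)
  have "c * (C * sqrt \<sigma>) * sqrt \<sigma> =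
      (c * \<delta> ^ ?n) * (\<sigma> * (\<kappa> powr ((real ?n - 1) / 2) * ((2 * \<kappa> * \<delta>) ^ k) ^ ?n))"
    by (simp add: C_def power_mult_distrib \<sigma>_def mult_ac)
  also have "\<dots> \<le> 1 * (\<sigma> * (\<kappa> * exp (- real k)) ^ ?n)"
    using scale(3) \<kappa>_ge_1 step(1) decay by (intro mult_mono powr_mult_power_le) (auto simp: \<sigma>_def)
  finally have "c * (C * sqrt \<sigma>) * sqrt \<sigma> \<le> t" using data_le by simp
  then show ?thesis
    unfolding w_def using step scale(1,2) C_nonneg kernel
    by (intro scaled_witness_small_data) (auto simp: w_def \<sigma>_def)
qed

lemma wavenumber_step_le_exp:
  fixes \<kappa> n K :: real
  assumes "0 \<le> \<kappa>" "3 * \<kappa> \<le> K" "0 < K" "1 \<le> n"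
  shows "2 * \<kappa> * (1 / (2 * n * K)) \<le> exp (- 1)"
proof -
  have "exp 1 * \<kappa> \<le> 3 * \<kappa>" using exp_le assms(1) by (rule mult_right_mono)
  also have "\<dots> \<le> 1 * K" using assms(2) by simp
  also have "\<dots> \<le> n * K" using assms(3,4) by (intro mult_right_mono) simp_all
  finally show ?thesis using assms(3,4) by (simp add: exp_minus field_simps)
qed

lemma exists_witness_of_order:
  assumes \<kappa>_ge_1: "1 \<le> \<kappa>" and order: "3 * \<kappa> \<le> real (Suc k)"
    and data_le: "measure (sphere_measure :: (real^'n::finite) measure) (sphere 0 1) *
      (\<kappa> * exp (- real k)) ^ CARD('n) \<le> t"
  shows "\<exists>h \<in> (small_data \<kappa> t :: (real^'n \<Rightarrow> complex) set).
    1 / (2 * pi * real CARD('n) * sqrt (1 + real CARD('n)) * real (Suc k)) \<le> L2_norm lborel h"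
proof -
  let ?n = "real CARD('n)"
  define M where "M = 2 * pi * ?n * sqrt (1 + ?n) * real (Suc k)"
  define \<delta> where "\<delta> = 1 / (2 * ?n * real (Suc k))"
  have n_ge_1: "1 \<le> ?n" by (simp add: Suc_leI)
  then have step: "0 < \<delta>" "\<delta> \<le> 1 / 2" "real (Suc k) * \<delta> * ?n < 1"
    using mult_mono[of 1 ?n 1 "real (Suc k)"] by (simp_all add: \<delta>_def field_simps)
  have decay: "2 * \<kappa> * \<delta> \<le> exp (- 1)"
    unfolding \<delta>_def using \<kappa>_ge_1 order n_ge_1 by (intro wavenumber_step_le_exp) simp_all
  define w where "w = (witness \<delta> k :: real^'n \<Rightarrow> complex)"
  have w_norm: "\<delta> ^ CARD('n) \<le> L2_norm lborel w" "0 < L2_norm lborel w"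
    using step power_le_L2_norm_witness[OF step(1,2), where 'n='n] less_le_trans[OF zero_less_power]
    unfolding w_def by blast+
  have M_ge_1: "1 \<le> M"
    unfolding M_def using pi_ge_two n_ge_1 by (intro mult_ge1_I) simp_all
  define c where "c = 1 / (M * L2_norm lborel w)"
  have scale_nonneg: "0 \<le> c" using M_ge_1 w_norm(2) by (simp add: c_def)
  have "H1_norm w \<le> M * L2_norm lborel w"
    using H1_norm_witness_le[of \<delta> k, where 'n='n] step
    by (simp add: w_def M_def \<delta>_def mult_ac del: of_nat_Suc)
  then have "c * H1_norm w \<le> 1"
    using M_ge_1 w_norm(2) by (simp add: c_def divide_le_eq)
  moreover have "c * L2_norm lborel w \<le> 1"
    using M_ge_1 w_norm(2) by (simp add: c_def divide_le_eq_1)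
  then have "c * \<delta> ^ CARD('n) \<le> 1"
    using mult_left_mono[OF w_norm(1) scale_nonneg] by linarith
  ultimately have "(\<lambda>x. of_real c * w x) \<in> small_data \<kappa> t"
    using \<kappa>_ge_1 step decay scale_nonneg data_le
    unfolding w_def by (intro scaled_witness_small_data_of_decay)
  moreover have "L2_norm lborel (\<lambda>x. of_real c * w x) = 1 / M"
    using scale_nonneg w_norm(2) by (simp add: L2_norm_cmult) (simp add: c_def)
  ultimately show ?thesis
    unfolding M_def by (intro bexI[of _ "\<lambda>x. of_real c * w x"]) simp_all
qed

lemma exists_order_of_decay:
  fixes \<kappa> t \<sigma> :: real
  assumes \<kappa>_ge_1: "1 \<le> \<kappa>" and t_le: "0 < t" "t \<le> exp (- 1)" and \<sigma>_nonneg: "0 \<le> \<sigma>"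
    and n_ge_1: "1 \<le> n"
  obtains k where "3 * \<kappa> \<le> real (Suc k)" "\<sigma> * (\<kappa> * exp (- real k)) ^ n \<le> t"
    "real (Suc k) \<le> (6 + ln (1 + \<sigma>)) * (\<kappa> * (ln \<kappa> + ln (1 / t))\<^sup>2)"
proof -
  define L where "L = ln \<kappa> + ln (1 / t)"
  define A where "A = ln (1 + \<sigma>)"
  have A_nonneg: "0 \<le> A" using \<sigma>_nonneg by (simp add: A_def)
  have "ln t \<le> - 1" using t_le ln_le_cancel_iff[of t "exp (- 1)"] by simp
  moreover have "0 \<le> ln \<kappa>" using \<kappa>_ge_1 by simp
  ultimately have L_ge_1: "1 \<le> L" using t_le(1) by (simp add: L_def ln_div)
  define k where "k = nat \<lceil>3 * \<kappa> + L + A\<rceil>"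
  have k_bounds: "3 * \<kappa> + L + A \<le> real k" "real k \<le> 3 * \<kappa> + L + A + 1"
    using \<kappa>_ge_1 L_ge_1 A_nonneg unfolding k_def by linarith+
  have "\<kappa> * exp (- real k) \<le> \<kappa> * exp (- L - A)"
    using k_bounds(1) \<kappa>_ge_1 by simp
  also have "\<dots> = t / (1 + \<sigma>)"
    using \<kappa>_ge_1 t_le(1) \<sigma>_nonneg
    by (simp add: L_def A_def exp_diff exp_minus exp_add ln_div divide_inverse)
  finally have decay: "\<kappa> * exp (- real k) \<le> t / (1 + \<sigma>)" .
  also have "t / (1 + \<sigma>) \<le> 1"
    using \<sigma>_nonneg order_trans[OF t_le(2), of 1] by (simp add: divide_le_eq_1)
  finally have "(\<kappa> * exp (- real k)) ^ n \<le> \<kappa> * exp (- real k)"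
    using \<kappa>_ge_1 n_ge_1 power_decreasing[of 1 n "\<kappa> * exp (- real k)"] by simp
  with decay have "\<sigma> * (\<kappa> * exp (- real k)) ^ n \<le> \<sigma> * (t / (1 + \<sigma>))"
    using \<sigma>_nonneg by (intro mult_left_mono) linarith
  also have "\<dots> \<le> t" using \<sigma>_nonneg t_le(1) by (simp add: divide_le_eq algebra_simps)
  finally have "\<sigma> * (\<kappa> * exp (- real k)) ^ n \<le> t" .
  moreover have \<kappa>_le: "\<kappa> \<le> \<kappa> * L\<^sup>2"
    using \<kappa>_ge_1 one_le_power[OF L_ge_1, of 2] mult_left_mono[of 1 "L\<^sup>2" \<kappa>] by simp
  have "1 * L \<le> (\<kappa> * L) * L"
    using \<kappa>_ge_1 L_ge_1 mult_mono[of 1 \<kappa> 1 L] by (intro mult_right_mono) auto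
  then have L_le: "L \<le> \<kappa> * L\<^sup>2" by (simp add: power2_eq_square mult.assoc)
  have "3 * \<kappa> + L + A * 1 + 2 \<le> 3 * (\<kappa> * L\<^sup>2) + \<kappa> * L\<^sup>2 + A * (\<kappa> * L\<^sup>2) + 2 * (\<kappa> * L\<^sup>2)"
    using \<kappa>_le L_le order_trans[OF \<kappa>_ge_1 \<kappa>_le] A_nonneg by (intro add_mono mult_left_mono) auto
  with k_bounds(2) have "real (Suc k) \<le> (6 + A) * (\<kappa> * L\<^sup>2)" by (simp add: algebra_simps)
  ultimately show ?thesis
    using that[of k] k_bounds(1) L_ge_1 A_nonneg unfolding L_def A_def by linarith
qed

lemma exists_logarithmic_witness:
  "\<exists>c>0. \<forall>\<kappa>\<ge>1. \<forall>t. 0 < t \<and> t \<le> exp (- 1) \<longrightarrow>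
    (\<exists>h \<in> (small_data \<kappa> t :: (real^'n::finite \<Rightarrow> complex) set).
      c * (1 / (\<kappa> * (ln \<kappa> + ln (1 / t))\<^sup>2)) \<le> L2_norm lborel h)"
proof -
  let ?n = "real CARD('n)"
  define \<sigma> where "\<sigma> = measure (sphere_measure :: (real^'n) measure) (sphere 0 1)"
  define M where "M = 2 * pi * ?n * sqrt (1 + ?n)"
  define A where "A = 6 + ln (1 + \<sigma>)"
  have "0 < M" "0 < A" by (simp_all add: M_def A_def \<sigma>_def add_pos_nonneg)
  have "\<exists>h \<in> (small_data \<kappa> t :: (real^'n \<Rightarrow> complex) set).
      1 / (M * A) * (1 / (\<kappa> * (ln \<kappa> + ln (1 / t))\<^sup>2)) \<le> L2_norm lborel h"
    if "1 \<le> \<kappa>" "0 < t" "t \<le> exp (- 1)" for \<kappa> t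
  proof -
    obtain k where order: "3 * \<kappa> \<le> real (Suc k)" "\<sigma> * (\<kappa> * exp (- real k)) ^ CARD('n) \<le> t"
      "real (Suc k) \<le> A * (\<kappa> * (ln \<kappa> + ln (1 / t))\<^sup>2)"
      using exists_order_of_decay[OF \<open>1 \<le> \<kappa>\<close> \<open>0 < t\<close> \<open>t \<le> exp (- 1)\<close>, of \<sigma> "CARD('n)"]
      unfolding A_def by (auto simp: \<sigma>_def Suc_leI)
    obtain h :: "real^'n \<Rightarrow> complex" where witness: "h \<in> small_data \<kappa> t"
      "1 / (M * real (Suc k)) \<le> L2_norm lborel h"
      using exists_witness_of_order[OF \<open>1 \<le> \<kappa>\<close> order(1) order(2)[unfolded \<sigma>_def]] unfolding M_def
      by blast
    have "M * real (Suc k) \<le> M * (A * (\<kappa> * (ln \<kappa> + ln (1 / t))\<^sup>2))"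
      using \<open>0 < M\<close> order(3) by (intro mult_left_mono) simp_all
    then have "1 / (M * A) * (1 / (\<kappa> * (ln \<kappa> + ln (1 / t))\<^sup>2)) \<le> 1 / (M * real (Suc k))"
      using \<open>0 < M\<close> frac_le[of 1 1 "M * real (Suc k)"] by (simp add: mult.assoc)
    with witness show ?thesis by (meson order_trans)
  qed
  then show ?thesis
    using \<open>0 < M\<close> \<open>0 < A\<close> by (intro exI[of _ "1 / (M * A)"]) auto
qed

theorem theorem1p5:
  assumes "CARD('n::finite) \<ge> 2"
  shows "\<exists>c c0 :: real. c > 0 \<and> c0 > 0 \<and>
    (\<forall>\<kappa>\<ge>1. \<forall>\<omega> :: real \<Rightarrow> real.
       \<omega> \<in> {0..} \<rightarrow> {0..} \<and> mono_on {0..} \<omega> \<and>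
       (\<forall>h :: real^'n \<Rightarrow> complex. h \<in> H1_ball \<and> H1_norm h \<le> 1 \<longrightarrow>
          L2_norm lborel h \<le> \<omega> (HS_norm sphere_measure (F_op \<kappa> h))) \<longrightarrow>
       (\<forall>t. 0 < t \<and> t \<le> c0 \<longrightarrow>
          \<omega> t \<ge> c * max t (1 / (\<kappa> * (ln \<kappa> + ln (1 / t))\<^sup>2))))"
proof -
  obtain a where linear: "a > 0" "\<And>\<kappa> t. \<kappa> \<ge> 1 \<Longrightarrow> 0 < t \<Longrightarrow> t \<le> 1 \<Longrightarrow>
      \<exists>h \<in> (small_data \<kappa> t :: (real^'n \<Rightarrow> complex) set). a * t \<le> L2_norm lborel h"
    using exists_linear_witness[where 'n='n] by blast
  obtain b where logarithmic: "b > 0" "\<And>\<kappa> t. \<kappa> \<ge> 1 \<Longrightarrow> 0 < t \<Longrightarrow> t \<le> exp (- 1) \<Longrightarrow>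
      \<exists>h \<in> (small_data \<kappa> t :: (real^'n \<Rightarrow> complex) set).
        b * (1 / (\<kappa> * (ln \<kappa> + ln (1 / t))\<^sup>2)) \<le> L2_norm lborel h"
    using exists_logarithmic_witness[where 'n='n] by blast
  have "min a b * max t s \<le> \<omega> t"
    if "\<kappa> \<ge> 1" "0 < t" "t \<le> exp (- 1)" and s_eq: "s = 1 / (\<kappa> * (ln \<kappa> + ln (1 / t))\<^sup>2)"
      and \<omega>_ge: "\<And>h :: real^'n \<Rightarrow> complex. h \<in> small_data \<kappa> t \<Longrightarrow> L2_norm lborel h \<le> \<omega> t" for \<kappa> t s \<omega>
  proof -
    have "t \<le> 1" using \<open>t \<le> exp (- 1)\<close> by (rule order_trans) simp
    then have "a * t \<le> \<omega> t" "b * s \<le> \<omega> t"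
      using linear(2)[of \<kappa> t] logarithmic(2)[of \<kappa> t] that by (blast intro: order_trans)+
    moreover have "0 \<le> s" using s_eq \<open>\<kappa> \<ge> 1\<close> by simp
    then have "min a b * t \<le> a * t" "min a b * s \<le> b * s"
      using \<open>0 < t\<close> by (auto intro!: mult_right_mono simp del: s_eq)
    ultimately show ?thesis by (simp add: max_def)
  qed
  then show ?thesis
    using linear(1) logarithmic(1) L2_norm_le_modulus
    by (intro exI[of _ "min a b"] exI[of _ "exp (- 1)"] conjI allI impI) (simp_all, blast)
qed

end
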